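(* Let $\Lambda$ be a pattern of homogeneity in $\mathbb{R}^d$ and let $T_1,\dots,T_\ell$ be $\Lambda$-homogeneous differential operators (with constant real coefficients) in $d$ variables. Suppose that all the monomials present in the operators $T_1,\dots,T_\ell$ have one and the same parity of degree. If there is a constant $C$ such that $$\|T_1 f\|_{L_1(\mathbb{R}^d)} \le C\sum_{j=2}^{\ell}\|T_j f\|_{L_1(\mathbb{R}^d)}\qquad\text{for all } f\in C_0^\infty(\mathbb{R}^d),$$ then $T_1$ is a linear combination of $T_2,\dots,T_\ell$.
   Context: A differential operator with constant coefficients is a finite sum $T=\sum_{\alpha} c_\alpha\partial^\alpha$ over multi-indices $\alpha=(\alpha_1,\dots,\alpha_d)\in\mathbb{Z}_{\ge 0}^d$, where $\partial^\alpha=\partial_1^{\alpha_1}\cdots\partial_d^{\alpha_d}$. The monomials present in $T$ are those $\partial^\alpha$ with $c_\alpha\ne 0$; the degree of the monomial $\partial^\alpha$ is $|\alpha|=\alpha_1+\dots+\alpha_d$. The Newton diagram of $T$ is the set $\{\alpha : c_\alpha\neq 0\}\subset\mathbb{R}^d$. A pattern of homogeneity is an affine hyperplane $\Lambda\subset\mathbb{R}^d$ that intersects all the (open) positive coordinate semi-axes. The operator $T$ is $\Lambda$-homogeneous if its Newton diagram lies on $\Lambda$. The condition "one and the same parity of degree" means that either $|\alpha|$ is even for all $\partial^\alpha$ present in any of the $T_j$, or $|\alpha|$ is odd for all of them. $C_0^\infty(\mathbb{R}^d)$ is the space of real-valued smooth compactly supported functions. Linear combinations are with real coefficients. *)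

theory Defs
  imports "HOL-Analysis.Analysis" "HOL-Library.Poly_Mapping"
begin

(* An operator with constant coefficients is the finitely supported family of its coefficients,
   indexed by multi-indices in nat ^ 'd; the dimension is CARD('d). *)
type_synonym 'd diff_op = "(nat ^ 'd) \<Rightarrow>\<^sub>0 real"

definition mdegree :: "nat ^ 'd::finite \<Rightarrow> nat" where
  "mdegree \<alpha> = (\<Sum>i\<in>UNIV. \<alpha> $ i)"

definition partial :: "'d::finite \<Rightarrow> (real ^ 'd \<Rightarrow> real) \<Rightarrow> real ^ 'd \<Rightarrow> real" where
  "partial i f x = deriv (\<lambda>t. f (x + t *\<^sub>R axis i 1)) 0"

(* The index type carries no order, so an arbitrary enumeration of the coordinates is fixed;
   for smooth functions its choice does not matter. *)
definition coords :: "'d::finite list" where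
  "coords = (SOME is. distinct is \<and> set is = UNIV)"

definition mpartial :: "nat ^ 'd::finite \<Rightarrow> (real ^ 'd \<Rightarrow> real) \<Rightarrow> real ^ 'd \<Rightarrow> real" where
  "mpartial \<alpha> f = foldr (\<lambda>i. partial i ^^ (\<alpha> $ i)) coords f"

definition apply_op :: "'d::finite diff_op \<Rightarrow> (real ^ 'd \<Rightarrow> real) \<Rightarrow> real ^ 'd \<Rightarrow> real" where
  "apply_op T f x = (\<Sum>\<alpha>\<in>Poly_Mapping.keys T. Poly_Mapping.lookup T \<alpha> * mpartial \<alpha> f x)"

(* Infinitely differentiable: every iterated partial derivative, of every order and in every
   sequence of directions, is (Frechet) differentiable everywhere, hence also continuous. *)
definition smooth :: "(real ^ 'd::finite \<Rightarrow> real) \<Rightarrow> bool" where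
  "smooth f \<longleftrightarrow> (\<forall>is. foldr partial is f differentiable_on UNIV)"

definition test_functions :: "(real ^ 'd::finite \<Rightarrow> real) set" where
  "test_functions = {f. smooth f \<and> compact (closure {x. f x \<noteq> 0})}"

(* Used only for continuous compactly supported functions, where the Bochner integral is
   the actual norm (on non-integrable functions it would default to 0). *)
definition L1_norm :: "(real ^ 'd::finite \<Rightarrow> real) \<Rightarrow> real" where
  "L1_norm f = (\<integral>x. \<bar>f x\<bar> \<partial>lborel)"

definition newton_diagram :: "'d::finite diff_op \<Rightarrow> (real ^ 'd) set" where
  "newton_diagram T = (\<lambda>\<alpha>. \<chi> i. real (\<alpha> $ i)) ` Poly_Mapping.keys T"

definition homogeneity_pattern :: "(real ^ 'd::finite) set \<Rightarrow> bool" where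
  "homogeneity_pattern \<Lambda> \<longleftrightarrow>
     (\<exists>a b. a \<noteq> 0 \<and> \<Lambda> = {x. a \<bullet> x = b}) \<and> (\<forall>i. \<exists>t>0. t *\<^sub>R axis i 1 \<in> \<Lambda>)"

definition homogeneous_op :: "(real ^ 'd::finite) set \<Rightarrow> 'd diff_op \<Rightarrow> bool" where
  "homogeneous_op \<Lambda> T \<longleftrightarrow> newton_diagram T \<subseteq> \<Lambda>"

definition same_degree_parity :: "'d::finite diff_op set \<Rightarrow> bool" where
  "same_degree_parity \<T> \<longleftrightarrow>
     (\<forall>T\<in>\<T>. \<forall>\<alpha>\<in>Poly_Mapping.keys T. even (mdegree \<alpha>)) \<or>
     (\<forall>T\<in>\<T>. \<forall>\<alpha>\<in>Poly_Mapping.keys T. odd (mdegree \<alpha>))"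

end

(*
  Replace the inequality by the statement that F(e) = |C| sum_j |T_j e| - |T_1 e|, a function of the
  vector e of values of the derivatives occurring in the operators, has nonnegative integral along
  the jets of all test functions. Adding to f a wave of small amplitude phi(x) and high anisotropic
  frequency r^a * xi perturbs its jet by phi(x) cos(theta) xdir(xi), up to o(1); here the equal parity
  of the degrees makes all derivatives oscillate in phase. Hence F stays admissible if it is replaced
  by the minimum of itself and its averages along xdir(xi). The infimum of all such relaxations is
  positively homogeneous, below the averages, hence convex in the directions xdir(xi), and vanishes
  at 0. By the theorem of Kirchheim and Kristensen it has a linear minorant on the span of these
  directions, which is the whole space. Thus F(e) + F(-e) >= 0, that is, |T_1 e| <= |C| sum_j |T_j e|
  for every vector e, and T_1 is a linear combination of the other operators.
*)

theory Submission
  imports Defs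
begin

section \<open>Smooth functions and test functions\<close>

text \<open>The weight vector \<open>a\<close> is read off from \<Lambda>: its entries are the
  reciprocals of the intercepts on the coordinate semi-axes, so every multi-index on \<Lambda> has
  weighted degree 1. Hence a wave of amplitude 1/r has derivatives of unit size, while each
  derivative that falls on the slowly varying factor instead of the cosine loses at least a power
  r^m. The obstacle is that one wave does not suffice, and superposing waves of many scales would
  require control of their interaction. Admissibility is therefore a property of the integrand,
  quantified over all test functions: each relaxation adds one wave, and induction over relaxations
  replaces the superposition. The value 0 at 0 survives every relaxation, since a negative average
  at 0 would contradict admissibility; with the common Lipschitz constant this keeps the infimum
  finite. The final inequality says that every e annihilated by T_2, ..., T_l is annihilated by T_1,
  and duality in finite dimension turns this into linear dependence.\<close>

lemma partial_eq:
  assumes "(f has_derivative f') (at x)"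
  shows "partial i f x = f' (axis i 1)"
proof -
  have f': "(f has_derivative f') (at (x + 0 *\<^sub>R axis i 1))"
    using assms by simp
  have "((\<lambda>t. f (x + t *\<^sub>R axis i 1)) has_derivative (\<lambda>t. f' (t *\<^sub>R axis i 1))) (at 0)"
    by (rule has_derivative_compose[of "\<lambda>t. x + t *\<^sub>R axis i 1", OF _ f'])
      (auto intro!: derivative_eq_intros)
  moreover have "linear f'"
    using assms has_derivative_linear by blast
  ultimately have "((\<lambda>t. f (x + t *\<^sub>R axis i 1)) has_derivative (\<lambda>t. f' (axis i 1) * t)) (at 0)"
    by (simp add: linear_scale mult.commute)
  then show ?thesis
    unfolding partial_def by (simp add: DERIV_imp_deriv has_field_derivative_def)
qed

lemma partial_const: "partial i (\<lambda>x. c) = (\<lambda>x. 0)"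
  using partial_eq[OF has_derivative_const] by fastforce

lemma partial_add:
  assumes "f differentiable_on UNIV" "g differentiable_on UNIV"
  shows "partial i (\<lambda>x. f x + g x) = (\<lambda>x. partial i f x + partial i g x)"
proof
  fix x
  obtain f' g' where f': "(f has_derivative f') (at x)" and g': "(g has_derivative g') (at x)"
    using assms unfolding differentiable_on_def differentiable_def by (meson UNIV_I)
  show "partial i (\<lambda>x. f x + g x) x = partial i f x + partial i g x"
    using partial_eq[OF f'] partial_eq[OF g'] partial_eq[OF has_derivative_add[OF f' g']] by simp
qed

lemma partial_mult:
  assumes "f differentiable_on UNIV" "g differentiable_on UNIV"
  shows "partial i (\<lambda>x. f x * g x) = (\<lambda>x. partial i f x * g x + f x * partial i g x)"
proof
  fix x
  obtain f' g' where f': "(f has_derivative f') (at x)" and g': "(g has_derivative g') (at x)"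
    using assms unfolding differentiable_on_def differentiable_def by (meson UNIV_I)
  show "partial i (\<lambda>x. f x * g x) x = partial i f x * g x + f x * partial i g x"
    using partial_eq[OF f'] partial_eq[OF g'] partial_eq[OF has_derivative_mult[OF f' g']] by simp
qed

text \<open>The algebra of functions generated by \<open>B\<close>. A concrete function is shown to
  be smooth by naming generators whose partial derivatives are again polynomials in
  generators.\<close>

inductive_set fun_alg :: "('a \<Rightarrow> real) set \<Rightarrow> ('a \<Rightarrow> real) set" for B where
  base: "f \<in> B \<Longrightarrow> f \<in> fun_alg B"
| const: "(\<lambda>x. c) \<in> fun_alg B"
| add: "f \<in> fun_alg B \<Longrightarrow> g \<in> fun_alg B \<Longrightarrow> (\<lambda>x. f x + g x) \<in> fun_alg B"
| mult: "f \<in> fun_alg B \<Longrightarrow> g \<in> fun_alg B \<Longrightarrow> (\<lambda>x. f x * g x) \<in> fun_alg B"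

text \<open>By linearity and the Leibniz rule, the condition on the generators passes to the whole
  algebra, so every iterated partial derivative stays inside it and is differentiable.\<close>

lemma smooth_fun_alg:
  assumes B: "\<And>f. f \<in> B \<Longrightarrow> f differentiable_on UNIV"
    "\<And>f i. f \<in> B \<Longrightarrow> partial i f \<in> fun_alg B"
    and f: "f \<in> fun_alg B"
  shows "smooth f"
proof -
  have step: "g differentiable_on UNIV \<and> (\<forall>i. partial i g \<in> fun_alg B)" if "g \<in> fun_alg B" for g
    using that
  proof induction
    case (base f)
    then show ?case using B by blast
  next
    case (const c)
    then show ?case by (auto simp: partial_const intro: fun_alg.const)
  next
    case (add f g)
    then show ?case by (auto simp: partial_add intro: fun_alg.add)
  next
    case (mult f g)
    then show ?case by (auto simp: partial_mult intro!: fun_alg.add fun_alg.mult differentiable_on_mult)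
  qed
  have "foldr partial is f \<in> fun_alg B" for "is"
    by (induction "is") (use f step in auto)
  then show ?thesis
    unfolding smooth_def using step by blast
qed

lemma smooth_differentiable: "smooth f \<Longrightarrow> f differentiable_on UNIV"
  unfolding smooth_def by (metis foldr_Nil id_apply)

lemma smooth_foldr_partial: "smooth f \<Longrightarrow> smooth (foldr partial is f)"
  unfolding smooth_def by (metis comp_apply foldr_append)

lemma smooth_partial: "smooth f \<Longrightarrow> smooth (partial i f)"
  using smooth_foldr_partial[of f "[i]"] by simp

lemma fun_alg_smooth: "f \<in> fun_alg {f. smooth f} \<Longrightarrow> smooth f"
  by (rule smooth_fun_alg) (auto intro: smooth_differentiable smooth_partial fun_alg.base)

lemma smooth_const: "smooth (\<lambda>x. c)"
  by (intro fun_alg_smooth fun_alg.intros)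

lemma smooth_add: "smooth f \<Longrightarrow> smooth g \<Longrightarrow> smooth (\<lambda>x. f x + g x)"
  by (intro fun_alg_smooth fun_alg.add fun_alg.base) auto

lemma smooth_mult: "smooth f \<Longrightarrow> smooth g \<Longrightarrow> smooth (\<lambda>x. f x * g x)"
  by (intro fun_alg_smooth fun_alg.mult fun_alg.base) auto

lemma smooth_diff: "smooth f \<Longrightarrow> smooth g \<Longrightarrow> smooth (\<lambda>x. f x - g x)"
  using smooth_add[of f "\<lambda>x. -1 * g x"] smooth_mult[OF smooth_const, of g "-1"] by simp

lemma smooth_power: "smooth f \<Longrightarrow> smooth (\<lambda>x. f x ^ n)"
  by (induction n) (auto intro: smooth_const smooth_mult)

lemma smooth_prod: "(\<And>i. i \<in> I \<Longrightarrow> smooth (f i)) \<Longrightarrow> smooth (\<lambda>x. \<Prod>i\<in>I. f i x)"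
  by (induction I rule: infinite_finite_induct) (auto intro: smooth_const smooth_mult)

lemma foldr_partial_add:
  assumes "smooth f" "smooth g"
  shows "foldr partial is (\<lambda>x. f x + g x) = (\<lambda>x. foldr partial is f x + foldr partial is g x)"
  by (induction "is") (use assms in \<open>auto simp: partial_add smooth_def\<close>)

lemma foldr_partial_cmult:
  assumes "smooth f"
  shows "foldr partial is (\<lambda>x. c * f x) = (\<lambda>x. c * foldr partial is f x)"
proof (induction "is")
  case (Cons i "is")
  have "foldr partial is f differentiable_on UNIV"
    using assms by (simp add: smooth_def)
  then show ?case
    by (simp add: Cons partial_mult partial_const)
qed auto

lemma foldr_partial_vanish:
  assumes "open U" "\<And>x. x \<in> U \<Longrightarrow> f x = 0" "x \<in> U"
  shows "foldr partial is f x = 0"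
  using assms(3)
proof (induction "is" arbitrary: x)
  case (Cons i "is")
  let ?g = "foldr partial is f"
  have "(?g has_derivative (\<lambda>_. 0)) (at x)"
    by (rule has_derivative_transform_within_open[OF _ assms(1) Cons.prems])
      (use Cons.IH in auto)
  from partial_eq[OF this] show ?case by simp
qed (use assms in auto)

text \<open>A multi-index written out as a list of directions, so that statements on iterated
  partial derivatives can be proved by induction on lists.\<close>

definition mindices :: "nat ^ 'd::finite \<Rightarrow> 'd list" where
  "mindices \<alpha> = concat (map (\<lambda>i. replicate (\<alpha> $ i) i) coords)"

lemma mpartial_eq_foldr: "mpartial \<alpha> f = foldr partial (mindices \<alpha>) f"
proof -
  have rep: "foldr partial (replicate n i) = partial i ^^ n" for n and i :: 'a
    by (induction n) auto
  have "foldr (\<lambda>i. partial i ^^ (\<alpha> $ i)) xs f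
      = foldr partial (concat (map (\<lambda>i. replicate (\<alpha> $ i) i) xs)) f" for xs
    by (induction xs) (auto simp: rep)
  then show ?thesis
    by (simp add: mpartial_def mindices_def)
qed

lemma coords: "distinct (coords :: 'd::finite list)" "set (coords :: 'd list) = UNIV"
  unfolding atomize_conj coords_def
  by (rule someI_ex) (use finite_distinct_list[OF finite[of UNIV]] in blast)

lemma mindices_sum_list:
  fixes g :: "'d::finite \<Rightarrow> real"
  shows "(\<Sum>i\<leftarrow>mindices \<alpha>. g i) = (\<Sum>i\<in>UNIV. real (\<alpha> $ i) * g i)"
proof -
  have "(\<Sum>i\<leftarrow>concat (map (\<lambda>i. replicate (\<alpha> $ i) i) xs). g i) = (\<Sum>i\<leftarrow>xs. real (\<alpha> $ i) * g i)" for xs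
    by (induction xs) (auto simp: sum_list_replicate)
  then show ?thesis
    using coords[where 'd='d] by (simp add: mindices_def sum_list_distinct_conv_sum_set)
qed

lemma mindices_prod_list:
  fixes g :: "'d::finite \<Rightarrow> real"
  shows "(\<Prod>i\<leftarrow>mindices \<alpha>. g i) = (\<Prod>i\<in>UNIV. g i ^ (\<alpha> $ i))"
proof -
  have "(\<Prod>i\<leftarrow>concat (map (\<lambda>i. replicate (\<alpha> $ i) i) xs). g i) = (\<Prod>i\<leftarrow>xs. g i ^ (\<alpha> $ i))" for xs
    by (induction xs) auto
  then show ?thesis
    using coords[where 'd='d] by (simp add: mindices_def flip: prod.distinct_set_conv_list)
qed

lemma mindices_length: "length (mindices \<alpha>) = mdegree \<alpha>"
proof -
  have "real (length (mindices \<alpha>)) = (\<Sum>i\<leftarrow>mindices \<alpha>. 1)"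
    by (simp add: sum_list_triv)
  also have "\<dots> = real (mdegree \<alpha>)"
    by (simp add: mindices_sum_list mdegree_def)
  finally show ?thesis by simp
qed

text \<open>The span of these functions is closed under differentiation, which yields smoothness at \<open>0\<close>.\<close>

definition flat :: "nat \<Rightarrow> real \<Rightarrow> real" where
  "flat k t = (if t > 0 then (1 / t) ^ k * exp (- (1 / t)) else 0)"

lemma flat_le: "\<bar>flat k t\<bar> \<le> fact (k + 2) * t\<^sup>2"
proof (cases "t > 0")
  case True
  define u where "u = 1 / t"
  define m :: real where "m = fact (k + 2)"
  have m: "m > 0" unfolding m_def by (rule fact_gt_zero)
  have u: "u > 0" "t = 1 / u" using True by (auto simp: u_def)
  have "u ^ (k + 2) / m \<le> exp u"
  proof -
    have "(\<Sum>n\<in>{k + 2}. u ^ n /\<^sub>R fact n) \<le> suminf (\<lambda>n. u ^ n /\<^sub>R fact n)"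
      using u by (intro sum_le_suminf summable_exp_generic) auto
    then show ?thesis by (simp add: exp_def divide_inverse_commute m_def)
  qed
  then have "u ^ k * exp (- u) \<le> m * (1 / u)\<^sup>2"
    using u m by (simp add: exp_minus field_simps power2_eq_square)
  then show ?thesis
    using True u by (simp add: flat_def m_def flip: u_def)
qed (auto simp: flat_def)

lemma flat_deriv: "(flat k has_real_derivative flat (k + 2) t - real k * flat (k + 1) t) (at t)"
proof -
  consider "t > 0" | "t < 0" | "t = 0" by linarith
  then show ?thesis
  proof cases
    case 1
    have d: "((\<lambda>t. 1 / t) has_real_derivative - ((1 / t)\<^sup>2)) (at t)"
      using 1 by (auto intro!: derivative_eq_intros simp: power2_eq_square)
    have "((\<lambda>t. (1 / t) ^ k * exp (- (1 / t))) has_real_derivative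
        flat (k + 2) t - real k * flat (k + 1) t) (at t)"
      by (rule DERIV_cong[OF DERIV_mult[OF DERIV_power[OF d] DERIV_chain2[OF DERIV_exp DERIV_minus[OF d]]]])
        (use 1 in \<open>cases k; simp add: flat_def power2_eq_square algebra_simps\<close>)
    moreover have ev: "\<forall>\<^sub>F s in nhds t. (1 / s) ^ k * exp (- (1 / s)) = flat k s"
      using eventually_nhds_in_open[of "{0<..}" t] 1
      by (auto simp: flat_def elim!: eventually_mono)
    ultimately show ?thesis
      using DERIV_cong_ev[OF refl ev refl] by blast
  next
    case 2
    moreover have "\<forall>\<^sub>F s in nhds t. flat k s = 0"
      using eventually_nhds_in_open[of "{..<0}" t] 2
      by (auto simp: flat_def elim!: eventually_mono)
    ultimately show ?thesis
      using DERIV_cong_ev[OF refl _ refl, of "flat k" "\<lambda>_. 0" t 0] by (simp add: flat_def)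
  next
    case 3
    have "((\<lambda>h. flat k h / h) \<longlongrightarrow> 0) (at 0)"
    proof (rule Lim_null_comparison)
      show "\<forall>\<^sub>F h in at 0. norm (flat k h / h) \<le> fact (k + 2) * \<bar>h\<bar>"
        using flat_le[of k]
        by (intro always_eventually)
          (auto simp: divide_le_eq abs_mult power2_eq_square mult.assoc)
      show "((\<lambda>h::real. fact (k + 2) * \<bar>h\<bar>) \<longlongrightarrow> 0) (at 0)"
        by (auto intro!: tendsto_eq_intros)
    qed
    then show ?thesis
      using 3 by (simp add: DERIV_def flat_def)
  qed
qed

text \<open>All orders \<open>k\<close> serve as generators at once, since a derivative raises
  \<open>k\<close> by 1 and by 2. The affine argument covers both factors of a bump, with
  \<open>s\<close> equal to 1 and to -1.\<close>

lemma smooth_flat: "smooth (\<lambda>x::real^'d::finite. flat k (s * x $ i + r))"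
proof -
  let ?B = "range (\<lambda>k (x::real^'d). flat k (s * x $ i + r))"
  have D: "((\<lambda>x::real^'d. flat k (s * x $ i + r)) has_derivative
      (\<lambda>h. (flat (k + 2) (s * x $ i + r) - real k * flat (k + 1) (s * x $ i + r)) * (s * h $ i))) (at x)"
    for k x
  proof -
    have "((\<lambda>x::real^'d. s * x $ i + r) has_derivative (\<lambda>h. s * h $ i)) (at x)"
      by (auto intro!: derivative_eq_intros bounded_linear.has_derivative[OF bounded_linear_vec_nth])
    then show ?thesis
      using has_derivative_compose flat_deriv[unfolded has_field_derivative_def] by blast
  qed
  have P: "partial j (\<lambda>x::real^'d. flat k (s * x $ i + r)) =
    (\<lambda>x. (s * axis j 1 $ i) * flat (k + 2) (s * x $ i + r)
      + (- real k * s * axis j 1 $ i) * flat (k + 1) (s * x $ i + r))" for k j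
    by (rule ext, subst partial_eq[OF D]) (simp add: algebra_simps)
  show ?thesis
  proof (rule smooth_fun_alg)
    show "f differentiable_on UNIV" if "f \<in> ?B" for f
      using that D by (auto simp: differentiable_on_def differentiable_def)
    show "partial j f \<in> fun_alg ?B" if fB: "f \<in> ?B" for f j
    proof -
      obtain k where f: "f = (\<lambda>x. flat k (s * x $ i + r))"
        using fB by blast
      show ?thesis
        unfolding f P by (intro fun_alg.add fun_alg.mult fun_alg.const fun_alg.base rangeI)
    qed
  qed (auto intro!: fun_alg.intros)
qed

definition bump :: "real^'d::finite \<Rightarrow> real^'d \<Rightarrow> real^'d \<Rightarrow> real" where
  "bump a b x = (\<Prod>i\<in>UNIV. flat 0 (x $ i - a $ i) * flat 0 (b $ i - x $ i))"

lemma smooth_bump: "smooth (bump a (b :: real^'d::finite))"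
proof -
  have "smooth (\<lambda>x::real^'d. \<Prod>i\<in>UNIV. flat 0 (1 * x $ i + - a $ i) * flat 0 (-1 * x $ i + b $ i))"
    by (intro smooth_prod smooth_mult smooth_flat)
  moreover have "bump a b = (\<lambda>x::real^'d. \<Prod>i\<in>UNIV. flat 0 (1 * x $ i + - a $ i) * flat 0 (-1 * x $ i + b $ i))"
    by (auto simp: bump_def fun_eq_iff)
  ultimately show ?thesis by simp
qed

lemma flat_0_bounds: "0 \<le> flat 0 t" "flat 0 t \<le> 1"
  by (auto simp: flat_def)

lemma bump_bounds: "0 \<le> bump a b x" "bump a b x \<le> 1"
  by (auto simp: bump_def intro!: prod_nonneg prod_le_1 mult_le_one mult_nonneg_nonneg flat_0_bounds)

lemma bump_pos_iff: "bump a b x > 0 \<longleftrightarrow> x \<in> box a b"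
proof -
  have "bump a b x > 0 \<longleftrightarrow> bump a b x \<noteq> 0"
    using bump_bounds(1)[of a b x] by linarith
  also have "\<dots> \<longleftrightarrow> x \<in> box a b"
    by (auto simp: bump_def flat_def mem_box_cart)
  finally show ?thesis .
qed

section \<open>Test functions: support, boundedness, closure under partial derivatives\<close>

lemma test_functions_smooth: "f \<in> test_functions \<Longrightarrow> smooth f"
  by (simp add: test_functions_def)

lemma test_functions_vanish:
  assumes "f \<in> test_functions"
  obtains S where "compact S" "\<And>x is. x \<notin> S \<Longrightarrow> foldr partial is f x = 0"
proof
  let ?S = "closure {x. f x \<noteq> 0}"
  show "compact ?S"
    using assms by (simp add: test_functions_def)
  show "foldr partial is f x = 0" if "x \<notin> ?S" for x "is"
    by (rule foldr_partial_vanish[of "- ?S"]) (use that closure_subset[of "{x. f x \<noteq> 0}"] in auto)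
qed

lemma test_functionsI:
  assumes "smooth f" "compact S" "\<And>x. x \<notin> S \<Longrightarrow> f x = 0"
  shows "f \<in> test_functions"
proof -
  have "closure {x. f x \<noteq> 0} \<subseteq> S"
    by (rule closure_minimal) (use assms compact_imp_closed in auto)
  then show ?thesis
    using assms compact_Int_closed[OF assms(2) closed_closure, of "{x. f x \<noteq> 0}"]
    by (auto simp: test_functions_def inf.absorb2)
qed

lemma test_functions_bounded:
  assumes "f \<in> test_functions"
  obtains B where "B \<ge> 0" "\<And>x. \<bar>f x\<bar> \<le> B"
proof -
  obtain S where S: "compact S" "\<And>x is. x \<notin> S \<Longrightarrow> foldr partial is f x = 0"
    using test_functions_vanish[OF assms] by blast
  have "continuous_on S f"
    using smooth_differentiable[OF test_functions_smooth[OF assms]]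
    by (meson continuous_on_subset differentiable_imp_continuous_on subset_UNIV)
  then have "bounded (f ` S)"
    using S(1) compact_continuous_image compact_imp_bounded by blast
  then obtain B where B: "\<And>x. x \<in> S \<Longrightarrow> \<bar>f x\<bar> \<le> B"
    by (auto simp: bounded_iff)
  have "\<bar>f x\<bar> \<le> max B 0" for x
    using B[of x] S(2)[of x "[]"] by (cases "x \<in> S") auto
  then show ?thesis
    using that[of "max B 0"] by auto
qed

lemma test_functions_partial:
  assumes "f \<in> test_functions"
  shows "partial i f \<in> test_functions"
proof -
  obtain S where S: "compact S" "\<And>x is. x \<notin> S \<Longrightarrow> foldr partial is f x = 0"
    using test_functions_vanish[OF assms] by blast
  show ?thesis
    using smooth_partial test_functions_smooth[OF assms] S(1) S(2)[of _ "[i]"]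
    by (auto intro!: test_functionsI)
qed

lemma continuous_mpartial:
  assumes "smooth f"
  shows "continuous_on S (mpartial \<alpha> f)"
  using assms unfolding mpartial_eq_foldr smooth_def
  by (meson continuous_on_subset differentiable_imp_continuous_on subset_UNIV)

section \<open>Anisotropic oscillations\<close>

text \<open>The derivative -sin is written as a cosine advanced by a quarter period. Cosines with
  all phases thus form a family closed under differentiation up to factors, and the phase counts the
  derivatives taken.\<close>

lemma has_derivative_cos_inner:
  "((\<lambda>x. cos (\<eta> \<bullet> x + t)) has_derivative (\<lambda>h. (\<eta> \<bullet> h) * cos (\<eta> \<bullet> x + (t + pi / 2)))) (at x)"
proof -
  have "cos (\<eta> \<bullet> x + (t + pi / 2)) = - sin (\<eta> \<bullet> x + t)"
    by (simp add: cos_add sin_add flip: add.assoc)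
  then show ?thesis
    by (auto intro!: derivative_eq_intros)
qed

lemma smooth_cos_inner: "smooth (\<lambda>x. cos (\<eta> \<bullet> x + t))"
proof -
  let ?B = "range (\<lambda>t x. cos (\<eta> \<bullet> x + t))"
  have P: "partial i (\<lambda>x. cos (\<eta> \<bullet> x + t)) = (\<lambda>x. (\<eta> $ i) * cos (\<eta> \<bullet> x + (t + pi / 2)))" for i t
    by (rule ext, subst partial_eq[OF has_derivative_cos_inner]) (simp add: inner_axis)
  show ?thesis
  proof (rule smooth_fun_alg)
    show "f differentiable_on UNIV" if "f \<in> ?B" for f
      using that has_derivative_cos_inner[of \<eta>] by (auto simp: differentiable_on_def differentiable_def)
    show "partial j f \<in> fun_alg ?B" if fB: "f \<in> ?B" for f j
    proof -
      obtain t where f: "f = (\<lambda>x. cos (\<eta> \<bullet> x + t))"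
        using fB by blast
      show ?thesis
        unfolding f P by (intro fun_alg.mult fun_alg.const fun_alg.base rangeI)
    qed
  qed (auto intro!: fun_alg.intros)
qed

definition osc :: "real^'d::finite \<Rightarrow> real \<Rightarrow> (real^'d \<Rightarrow> real) \<Rightarrow> real^'d \<Rightarrow> real" where
  "osc \<eta> t \<psi> x = \<psi> x * cos (\<eta> \<bullet> x + t)"

lemma smooth_osc: "smooth \<psi> \<Longrightarrow> smooth (osc \<eta> t \<psi>)"
  unfolding osc_def using smooth_mult smooth_cos_inner by fastforce

lemma osc_le: "\<bar>osc \<eta> t \<psi> x\<bar> \<le> \<bar>\<psi> x\<bar>"
  unfolding osc_def abs_mult by (rule mult_left_le) (auto simp: abs_cos_le_one)

lemma partial_osc:
  assumes "smooth \<psi>"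
  shows "partial i (osc \<eta> t \<psi>) = (\<lambda>x. osc \<eta> t (partial i \<psi>) x + \<eta> $ i * osc \<eta> (t + pi / 2) \<psi> x)"
proof
  fix x
  have "osc \<eta> t \<psi> = (\<lambda>x. \<psi> x * cos (\<eta> \<bullet> x + t))"
    by (auto simp: osc_def)
  then show "partial i (osc \<eta> t \<psi>) x = osc \<eta> t (partial i \<psi>) x + \<eta> $ i * osc \<eta> (t + pi / 2) \<psi> x"
    using partial_mult[OF smooth_differentiable[OF assms] smooth_differentiable[OF smooth_cos_inner]]
    by (simp add: partial_eq[OF has_derivative_cos_inner] osc_def inner_axis)
qed

text \<open>The anisotropic dilation of \<xi> with weights \<open>a\<close>: a derivative in
  direction \<open>i\<close> that falls on the wave brings out a factor of order r^(a_i).\<close>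

definition freq :: "(real^'d::finite) \<Rightarrow> real^'d \<Rightarrow> real \<Rightarrow> real^'d" where
  "freq a \<xi> r = (\<chi> i. r powr (a $ i) * \<xi> $ i)"

text \<open>The leading term arises when all derivatives fall on the cosine. A derivative that falls
  on \<psi> instead forgoes a factor r^(a_i), at least r^m, so all other terms of the Leibniz rule
  fit into the error. The constant is uniform in \<open>r\<close>, the phase and the point.\<close>

lemma foldr_partial_osc:
  fixes \<psi> :: "real^'d::finite \<Rightarrow> real"
  assumes "\<psi> \<in> test_functions" and m: "0 \<le> m" "\<And>i. m \<le> a $ i"
  shows "\<exists>C\<ge>0. \<forall>r\<ge>1. \<forall>t x.
    \<bar>foldr partial js (osc (freq a \<xi> r) t \<psi>) x
      - r powr (\<Sum>i\<leftarrow>js. a $ i) * (\<Prod>i\<leftarrow>js. \<xi> $ i) * osc (freq a \<xi> r) (t + real (length js) * (pi / 2)) \<psi> x\<bar>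
    \<le> C * r powr ((\<Sum>i\<leftarrow>js. a $ i) - m)"
  using assms(1)
\<comment> \<open>\<open>foldr\<close> applies the last direction first, so the list is taken apart
  from the right; \<psi> is generalized because the Leibniz rule replaces it by its partial
  derivative.\<close>
proof (induction js arbitrary: \<psi> rule: rev_induct)
  case Nil
  show ?case by (intro exI[of _ 0]) auto
next
  case (snoc i js)
  define s where "s = (\<Sum>i\<leftarrow>js. a $ i)"
  define P where "P = (\<Prod>i\<leftarrow>js. \<xi> $ i)"
  define n where "n = real (length js) * (pi / 2)"
  define E where "E r t \<psi> x = foldr partial js (osc (freq a \<xi> r) t \<psi>) x
      - r powr s * P * osc (freq a \<xi> r) (t + n) \<psi> x" for r t \<psi> x
  have sm: "smooth \<psi>" "smooth (partial i \<psi>)"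
    using snoc.prems test_functions_smooth smooth_partial by auto
  obtain C1 where C1: "C1 \<ge> 0" "\<And>r t x. r \<ge> 1 \<Longrightarrow> \<bar>E r t (partial i \<psi>) x\<bar> \<le> C1 * r powr (s - m)"
    using snoc.IH[OF test_functions_partial[OF snoc.prems, of i]] unfolding E_def s_def P_def n_def by blast
  obtain C2 where C2: "C2 \<ge> 0" "\<And>r t x. r \<ge> 1 \<Longrightarrow> \<bar>E r t \<psi> x\<bar> \<le> C2 * r powr (s - m)"
    using snoc.IH[OF snoc.prems] unfolding E_def s_def P_def n_def by blast
  obtain B where B: "B \<ge> 0" "\<And>x. \<bar>partial i \<psi> x\<bar> \<le> B"
    using test_functions_bounded[OF test_functions_partial[OF snoc.prems, of i]] by blast
  show ?case
  proof (intro exI[of _ "C1 + \<bar>P\<bar> * B + \<bar>\<xi> $ i\<bar> * C2"] conjI allI impI)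
    show "0 \<le> C1 + \<bar>P\<bar> * B + \<bar>\<xi> $ i\<bar> * C2"
      using B C1 C2 by simp
    fix r t :: real and x :: "real^'d"
    assume r: "1 \<le> r"
    let ?\<eta> = "freq a \<xi> r" and ?R = "r powr (s + a $ i - m)"
    have s1: "r powr (s - m) * r powr (a $ i) = ?R"
      by (simp add: algebra_simps flip: powr_add)
    have s2: "r powr s \<le> ?R"
      using r m(2)[of i] by (intro powr_mono) auto
    have s3: "r powr (s - m) \<le> ?R"
      using r m(1) m(2)[of i] by (intro powr_mono) auto
    have "foldr partial (js @ [i]) (osc ?\<eta> t \<psi>) x =
      foldr partial js (osc ?\<eta> t (partial i \<psi>)) x + ?\<eta> $ i * foldr partial js (osc ?\<eta> (t + pi / 2) \<psi>) x"
      using foldr_partial_add[OF smooth_osc[OF sm(2)] smooth_mult[OF smooth_const smooth_osc[OF sm(1)]]]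
        foldr_partial_cmult[OF smooth_osc[OF sm(1)]]
      by (simp add: partial_osc sm)
    also have "\<dots> = E r t (partial i \<psi>) x + r powr s * P * osc ?\<eta> (t + n) (partial i \<psi>) x
        + ?\<eta> $ i * E r (t + pi / 2) \<psi> x + ?\<eta> $ i * (r powr s * P * osc ?\<eta> (t + pi / 2 + n) \<psi> x)"
      by (simp add: E_def algebra_simps)
    also have "?\<eta> $ i * (r powr s * P * osc ?\<eta> (t + pi / 2 + n) \<psi> x) = r powr (\<Sum>i\<leftarrow>js @ [i]. a $ i)
        * (\<Prod>i\<leftarrow>js @ [i]. \<xi> $ i) * osc ?\<eta> (t + real (length (js @ [i])) * (pi / 2)) \<psi> x"
      by (simp add: freq_def s_def P_def n_def powr_add algebra_simps add_divide_distrib)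
    finally have eq: "foldr partial (js @ [i]) (osc ?\<eta> t \<psi>) x
        - r powr (\<Sum>i\<leftarrow>js @ [i]. a $ i) * (\<Prod>i\<leftarrow>js @ [i]. \<xi> $ i)
          * osc ?\<eta> (t + real (length (js @ [i])) * (pi / 2)) \<psi> x
      = E r t (partial i \<psi>) x + r powr s * P * osc ?\<eta> (t + n) (partial i \<psi>) x
        + ?\<eta> $ i * E r (t + pi / 2) \<psi> x"
      by simp
    have "\<bar>E r t (partial i \<psi>) x\<bar> \<le> C1 * ?R"
      using C1 r s3 by (meson mult_left_mono order_trans)
    moreover have "\<bar>r powr s * P * osc ?\<eta> (t + n) (partial i \<psi>) x\<bar> \<le> \<bar>P\<bar> * B * ?R"
    proof -
      have "\<bar>osc ?\<eta> (t + n) (partial i \<psi>) x\<bar> \<le> B"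
        using osc_le B(2) order_trans by blast
      then have "r powr s * (\<bar>P\<bar> * \<bar>osc ?\<eta> (t + n) (partial i \<psi>) x\<bar>) \<le> ?R * (\<bar>P\<bar> * B)"
        using s2 B by (intro mult_mono) auto
      then show ?thesis by (simp add: abs_mult algebra_simps)
    qed
    moreover have "\<bar>?\<eta> $ i * E r (t + pi / 2) \<psi> x\<bar> \<le> \<bar>\<xi> $ i\<bar> * C2 * ?R"
    proof -
      have "r powr (a $ i) * \<bar>\<xi> $ i\<bar> * \<bar>E r (t + pi / 2) \<psi> x\<bar>
          \<le> r powr (a $ i) * \<bar>\<xi> $ i\<bar> * (C2 * r powr (s - m))"
        using C2 r by (intro mult_left_mono) auto
      also have "\<dots> = \<bar>\<xi> $ i\<bar> * C2 * ?R"
        unfolding s1[symmetric] by (simp add: algebra_simps)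
      finally show ?thesis by (simp add: freq_def abs_mult)
    qed
    ultimately have "\<bar>E r t (partial i \<psi>) x + r powr s * P * osc ?\<eta> (t + n) (partial i \<psi>) x
        + ?\<eta> $ i * E r (t + pi / 2) \<psi> x\<bar> \<le> (C1 + \<bar>P\<bar> * B + \<bar>\<xi> $ i\<bar> * C2) * ?R"
      unfolding distrib_right by linarith
    then show "\<bar>foldr partial (js @ [i]) (osc ?\<eta> t \<psi>) x
        - r powr (\<Sum>i\<leftarrow>js @ [i]. a $ i) * (\<Prod>i\<leftarrow>js @ [i]. \<xi> $ i)
          * osc ?\<eta> (t + real (length (js @ [i])) * (pi / 2)) \<psi> x\<bar>
      \<le> (C1 + \<bar>P\<bar> * B + \<bar>\<xi> $ i\<bar> * C2) * r powr ((\<Sum>i\<leftarrow>js @ [i]. a $ i) - m)"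
      unfolding eq by (simp add: s_def)
  qed
qed

text \<open>The amplitudes of the derivatives of a plane wave with frequency \<xi>: the monomial of
  \<xi>, with the sign produced by pairs of differentiations of a cosine. The quarter-period phase
  of odd degrees is left to the cosine.\<close>

definition xdir :: "real^'d::finite \<Rightarrow> nat^'d \<Rightarrow> real" where
  "xdir \<xi> \<alpha> = (-1) ^ (mdegree \<alpha> div 2) * (\<Prod>i\<in>UNIV. \<xi> $ i ^ (\<alpha> $ i))"

text \<open>Two quarter periods change the sign. What remains is a phase that depends only on the
  parity of \<open>n\<close>.\<close>

lemma cos_add_quarters: "cos (x + real n * (pi / 2)) = (-1) ^ (n div 2) * cos (x + real (n mod 2) * (pi / 2))"
proof -
  have eq: "real n * (pi / 2) = real (n mod 2) * (pi / 2) + real (n div 2) * pi"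
  proof -
    have "real n = real (n mod 2) + 2 * real (n div 2)"
      by (metis add.commute mult_div_mod_eq of_nat_add of_nat_mult of_nat_numeral)
    then show ?thesis by (simp add: algebra_simps)
  qed
  then show ?thesis
    unfolding eq add.assoc[symmetric] cos_add[of _ "real (n div 2) * pi"] by (simp add: cos_npi)
qed

text \<open>Weighted degree 1 makes the leading term of order \<open>r\<close> whatever \<alpha> is,
  so dividing by \<open>r\<close> normalizes all derivatives simultaneously.\<close>

lemma mpartial_osc:
  fixes \<psi> :: "real^'d::finite \<Rightarrow> real"
  assumes \<psi>: "\<psi> \<in> test_functions" and m: "0 \<le> m" "\<And>i. m \<le> a $ i"
    and \<alpha>: "(\<Sum>i\<in>UNIV. real (\<alpha> $ i) * a $ i) = 1"
  shows "\<exists>C\<ge>0. \<forall>r\<ge>1. \<forall>t x.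
    \<bar>mpartial \<alpha> (osc (freq a \<xi> r) t \<psi>) x / r
      - \<psi> x * cos (freq a \<xi> r \<bullet> x + t + real (mdegree \<alpha> mod 2) * (pi / 2)) * xdir \<xi> \<alpha>\<bar> \<le> C * r powr (- m)"
proof -
  obtain C where C: "C \<ge> 0" "\<And>r t x. r \<ge> 1 \<Longrightarrow>
    \<bar>mpartial \<alpha> (osc (freq a \<xi> r) t \<psi>) x - r * (\<Prod>i\<in>UNIV. \<xi> $ i ^ (\<alpha> $ i))
      * osc (freq a \<xi> r) (t + real (mdegree \<alpha>) * (pi / 2)) \<psi> x\<bar> \<le> C * r powr (1 - m)"
    using foldr_partial_osc[OF \<psi> m, where \<xi> = \<xi> and js = "mindices \<alpha>"]
    unfolding mindices_sum_list mindices_prod_list mindices_length \<alpha> mpartial_eq_foldr by fastforce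
  show ?thesis
  proof (intro exI[of _ C] conjI allI impI C)
    fix r t :: real and x :: "real^'d"
    assume r: "1 \<le> r"
    define X where "X = mpartial \<alpha> (osc (freq a \<xi> r) t \<psi>) x"
    define Y where "Y = \<psi> x * cos (freq a \<xi> r \<bullet> x + t + real (mdegree \<alpha> mod 2) * (pi / 2)) * xdir \<xi> \<alpha>"
    have "(\<Prod>i\<in>UNIV. \<xi> $ i ^ (\<alpha> $ i)) * osc (freq a \<xi> r) (t + real (mdegree \<alpha>) * (pi / 2)) \<psi> x = Y"
      unfolding Y_def osc_def add.assoc[symmetric] cos_add_quarters[of _ "mdegree \<alpha>"] by (simp add: xdir_def)
    then have "\<bar>X - r * Y\<bar> \<le> C * r powr (1 - m)"
      using C(2)[OF r, of t x] by (simp add: X_def mult.assoc)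
    moreover have "\<bar>X / r - Y\<bar> = \<bar>X - r * Y\<bar> / r"
      using r by (simp add: field_simps abs_divide flip: abs_divide[of _ r])
    moreover have "r powr (1 - m) = r * r powr (- m)"
      using r by (simp add: powr_diff powr_minus divide_inverse)
    ultimately show "\<bar>X / r - Y\<bar> \<le> C * r powr (- m)"
      using r by (simp add: divide_le_eq mult_ac)
  qed
qed

section \<open>Averages along a direction\<close>

definition avg :: "(real \<Rightarrow> real) \<Rightarrow> real" where
  "avg g = integral {0..2 * pi} g / (2 * pi)"

lemma avg_integrable: "continuous_on UNIV (g :: real \<Rightarrow> real) \<Longrightarrow> g integrable_on {a..b}"
  by (meson continuous_on_subset integrable_continuous_real subset_UNIV)

lemma avg_const: "avg (\<lambda>t. c) = c"
  by (simp add: avg_def)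

lemma avg_cmult: "avg (\<lambda>t. c * g t) = c * avg g"
  by (simp add: avg_def)

lemma avg_mono:
  assumes "continuous_on UNIV g" "continuous_on UNIV h" "\<And>t. g t \<le> h t"
  shows "avg g \<le> avg h"
  unfolding avg_def
  by (intro divide_right_mono integral_le avg_integrable assms) auto

lemma avg_add:
  assumes "continuous_on UNIV g" "continuous_on UNIV h"
  shows "avg (\<lambda>t. g t + h t) = avg g + avg h"
  using assms by (simp add: avg_def add_divide_distrib Henstock_Kurzweil_Integration.integral_add avg_integrable)

lemma avg_dist:
  assumes "continuous_on UNIV g" "continuous_on UNIV h" "\<And>t. \<bar>g t - h t\<bar> \<le> B"
  shows "\<bar>avg g - avg h\<bar> \<le> B"
proof -
  have "avg g \<le> avg (\<lambda>t. h t + B)" "avg h \<le> avg (\<lambda>t. g t + B)"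
    by (intro avg_mono continuous_intros assms; use assms(3) in \<open>simp add: abs_le_iff algebra_simps\<close>)+
  then show ?thesis
    using assms by (simp add: avg_add avg_const continuous_on_const)
qed

text \<open>By periodicity the shift is reduced to one period, and the part of the shifted interval
  beyond \<open>2 * pi\<close> is moved back to the start.\<close>

lemma avg_cos_shift:
  assumes h: "continuous_on UNIV h"
  shows "avg (\<lambda>t. h (cos (t + w))) = avg (\<lambda>t. h (cos t))"
proof -
  define n where "n = \<lfloor>w / (2 * pi)\<rfloor>"
  define s where "s = w - 2 * pi * n"
  have s: "0 \<le> s" "s \<le> 2 * pi"
    using floor_divide_lower[of "2 * pi" w] floor_divide_upper[of "2 * pi" w]
    by (auto simp: n_def s_def algebra_simps)
  have per: "cos (t + 2 * pi * of_int k) = cos t" for t and k :: int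
    unfolding cos_add cos_int_2pin sin_int_2pin by simp
  have c: "continuous_on UNIV (\<lambda>t. h (cos t))"
    by (intro continuous_on_compose2[OF h] continuous_intros) auto
  have "cos (t + w) = cos (t + s)" for t
    using per[of "t + s" n] by (simp add: s_def add.assoc)
  then have "integral {0..2 * pi} (\<lambda>t. h (cos (t + w))) = integral {0..2 * pi} (\<lambda>t. h (cos (t + s)))"
    by simp
  also have "\<dots> = integral {s..2 * pi + s} (\<lambda>t. h (cos t))"
    using integral_shift_Icc_real[of 0 "2 * pi" "\<lambda>t. h (cos t)" s] by (simp add: o_def add.commute)
  also have "\<dots> = integral {s..2 * pi} (\<lambda>t. h (cos t)) + integral {2 * pi..2 * pi + s} (\<lambda>t. h (cos t))"
    using s by (intro Henstock_Kurzweil_Integration.integral_combine[symmetric] avg_integrable c) auto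
  also have "integral {2 * pi..2 * pi + s} (\<lambda>t. h (cos t)) = integral {0..s} (\<lambda>t. h (cos t))"
    using integral_shift_Icc_real[of 0 s "\<lambda>t. h (cos t)" "2 * pi"] per[of _ 1]
    by (simp add: o_def add.commute)
  also have "integral {s..2 * pi} (\<lambda>t. h (cos t)) + \<dots> = integral {0..2 * pi} (\<lambda>t. h (cos t))"
    using s by (subst add.commute, intro Henstock_Kurzweil_Integration.integral_combine avg_integrable c) auto
  finally show ?thesis
    by (simp add: avg_def)
qed

text \<open>Only the coordinates in \<open>A\<close> enter the bound, so such a \<open>G\<close>
  cannot depend on the others. Vectors can therefore be arbitrary functions on all
  multi-indices.\<close>

definition lip :: "'a set \<Rightarrow> real \<Rightarrow> (('a \<Rightarrow> real) \<Rightarrow> real) \<Rightarrow> bool" where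
  "lip A K G \<longleftrightarrow> (\<forall>e e'. \<bar>G e - G e'\<bar> \<le> K * (\<Sum>\<alpha>\<in>A. \<bar>e \<alpha> - e' \<alpha>\<bar>))"

lemma lip_continuous_on:
  assumes G: "lip A K G" and v: "\<And>\<alpha>. \<alpha> \<in> A \<Longrightarrow> continuous_on S (\<lambda>z. v z \<alpha>)"
  shows "continuous_on S (\<lambda>z. G (v z))"
  unfolding continuous_on_def
proof
  fix z assume z: "z \<in> S"
  have "((\<lambda>y. K * (\<Sum>\<alpha>\<in>A. \<bar>v y \<alpha> - v z \<alpha>\<bar>)) \<longlongrightarrow> K * (\<Sum>\<alpha>\<in>A. \<bar>v z \<alpha> - v z \<alpha>\<bar>)) (at z within S)"
    using v z unfolding continuous_on_def by (intro tendsto_intros) auto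
  then have "((\<lambda>y. K * (\<Sum>\<alpha>\<in>A. \<bar>v y \<alpha> - v z \<alpha>\<bar>)) \<longlongrightarrow> 0) (at z within S)"
    by simp
  then have "((\<lambda>y. G (v y) - G (v z)) \<longlongrightarrow> 0) (at z within S)"
    by (rule Lim_null_comparison[rotated])
      (use G in \<open>auto simp: lip_def intro!: always_eventually\<close>)
  then show "((\<lambda>z. G (v z)) \<longlongrightarrow> G (v z)) (at z within S)"
    by (simp add: LIM_zero_iff)
qed

text \<open>The points of the line are weighted by the distribution of the values of a cosine,
  because this is what a wave of amplitude \<open>c\<close> produces.\<close>

definition line_avg :: "(('a \<Rightarrow> real) \<Rightarrow> real) \<Rightarrow> ('a \<Rightarrow> real) \<Rightarrow> real \<Rightarrow> ('a \<Rightarrow> real) \<Rightarrow> real" where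
  "line_avg G x c e = avg (\<lambda>t. G (\<lambda>\<alpha>. e \<alpha> + c * cos t * x \<alpha>))"

lemma line_avg_lip:
  assumes G: "lip A K G" and K: "K \<ge> 0"
  shows "\<bar>line_avg G x c e - line_avg G x c' e'\<bar>
    \<le> K * ((\<Sum>\<alpha>\<in>A. \<bar>e \<alpha> - e' \<alpha>\<bar>) + \<bar>c - c'\<bar> * (\<Sum>\<alpha>\<in>A. \<bar>x \<alpha>\<bar>))"
  unfolding line_avg_def
proof (intro avg_dist lip_continuous_on[OF G] continuous_intros)
  fix t
  let ?e = "\<lambda>\<alpha>. e \<alpha> + c * cos t * x \<alpha>" and ?e' = "\<lambda>\<alpha>. e' \<alpha> + c' * cos t * x \<alpha>"
  have "\<bar>?e \<alpha> - ?e' \<alpha>\<bar> \<le> \<bar>e \<alpha> - e' \<alpha>\<bar> + \<bar>c - c'\<bar> * \<bar>x \<alpha>\<bar>" for \<alpha>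
  proof -
    have "\<bar>?e \<alpha> - ?e' \<alpha>\<bar> = \<bar>(e \<alpha> - e' \<alpha>) + cos t * ((c - c') * x \<alpha>)\<bar>"
      by (simp add: algebra_simps)
    also have "\<dots> \<le> \<bar>e \<alpha> - e' \<alpha>\<bar> + \<bar>cos t\<bar> * \<bar>(c - c') * x \<alpha>\<bar>"
      unfolding abs_mult[symmetric] by (rule abs_triangle_ineq)
    also have "\<dots> \<le> \<bar>e \<alpha> - e' \<alpha>\<bar> + \<bar>(c - c') * x \<alpha>\<bar>"
      by (intro add_left_mono mult_left_le_one_le) auto
    finally show ?thesis by (simp add: abs_mult)
  qed
  then have "(\<Sum>\<alpha>\<in>A. \<bar>?e \<alpha> - ?e' \<alpha>\<bar>) \<le> (\<Sum>\<alpha>\<in>A. \<bar>e \<alpha> - e' \<alpha>\<bar> + \<bar>c - c'\<bar> * \<bar>x \<alpha>\<bar>)"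
    by (rule sum_mono)
  moreover have "\<bar>G ?e - G ?e'\<bar> \<le> K * (\<Sum>\<alpha>\<in>A. \<bar>?e \<alpha> - ?e' \<alpha>\<bar>)"
    using G unfolding lip_def by blast
  ultimately show "\<bar>G ?e - G ?e'\<bar> \<le> K * ((\<Sum>\<alpha>\<in>A. \<bar>e \<alpha> - e' \<alpha>\<bar>) + \<bar>c - c'\<bar> * (\<Sum>\<alpha>\<in>A. \<bar>x \<alpha>\<bar>))"
    using K unfolding sum.distrib sum_distrib_left[symmetric] by (meson mult_left_mono order_trans)
qed

lemma lip_line_avg:
  assumes "lip A K G" "K \<ge> 0"
  shows "lip A K (line_avg G x c)"
  using line_avg_lip[OF assms, of x c _ c] by (simp add: lip_def)

lemma line_avg_mono:
  assumes "lip A K G" "lip A K' H" "\<And>e. G e \<le> H e"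
  shows "line_avg G x c e \<le> line_avg H x c e"
  unfolding line_avg_def
  by (intro avg_mono lip_continuous_on[OF assms(1)] lip_continuous_on[OF assms(2)] continuous_intros assms(3))

lemma line_avg_zero: "line_avg G x 0 e = G e"
  by (simp add: line_avg_def avg_const)

text \<open>A box outside which \<open>f\<close> vanishes stands in for the whole space: as
  \<open>G\<close> vanishes at 0, enlarging the box does not change the integral, and only
  continuous integrands on compact boxes occur.\<close>

definition admissible :: "(nat^'d::finite) set \<Rightarrow> real \<Rightarrow> ((nat^'d \<Rightarrow> real) \<Rightarrow> real) \<Rightarrow> bool" where
  "admissible A K G \<longleftrightarrow> lip A K G \<and> G (\<lambda>_. 0) = 0 \<and>
    (\<forall>f\<in>test_functions. \<forall>u v. (\<forall>x. x \<notin> cbox u v \<longrightarrow> f x = 0) \<longrightarrow>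
      0 \<le> integral (cbox u v) (\<lambda>x. G (\<lambda>\<alpha>. mpartial \<alpha> f x)))"

lemma lip_mpartial_continuous:
  assumes "lip A K G" "smooth f"
  shows "continuous_on S (\<lambda>x. G (\<lambda>\<alpha>. mpartial \<alpha> f x))"
  by (rule lip_continuous_on[OF assms(1)]) (rule continuous_mpartial[OF assms(2)])

text \<open>Admissibility is applied to \<open>f\<close> plus a wave of amplitude \<phi> / r, for
  every phase \<open>t\<close>. Averaging these bounds over \<open>t\<close> and interchanging the
  integrals yields a full average at each point, already at finite frequency; letting
  \<open>r\<close> tend to infinity only removes the error in the jet.\<close>

lemma admissible_line_avg:
  fixes A :: "(nat^'d::finite) set"
  assumes A: "finite A" and m: "0 < m" "\<And>i. m \<le> a $ i"
    and hom: "\<And>\<alpha>. \<alpha> \<in> A \<Longrightarrow> (\<Sum>i\<in>UNIV. real (\<alpha> $ i) * a $ i) = 1"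
    and par: "\<And>\<alpha>. \<alpha> \<in> A \<Longrightarrow> mdegree \<alpha> mod 2 = p"
    and G: "admissible A K G" and K: "K \<ge> 0"
    and f: "f \<in> test_functions" "\<And>x. x \<notin> cbox u v \<Longrightarrow> f x = 0"
    and \<phi>: "\<phi> \<in> test_functions" "\<And>x. x \<notin> cbox u v \<Longrightarrow> \<phi> x = 0"
  shows "0 \<le> integral (cbox u v) (\<lambda>x. line_avg G (xdir \<xi>) (\<phi> x) (\<lambda>\<alpha>. mpartial \<alpha> f x))"
    (is "0 \<le> ?I")
proof -
  have L: "lip A K G" using G by (simp add: admissible_def)
  have sm: "smooth f" "smooth \<phi>" using f \<phi> test_functions_smooth by auto
  \<comment> \<open>The phase common to all derivatives, because all degrees in \<open>A\<close>
    have the same remainder \<open>p\<close> modulo 2.\<close>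
  define q where "q = real p * (pi / 2)"
  define g where "g r t x = G (\<lambda>\<alpha>. mpartial \<alpha> f x + \<phi> x * cos (freq a \<xi> r \<bullet> x + t + q) * xdir \<xi> \<alpha>)" for r t x
  have "\<exists>C. \<forall>\<alpha>\<in>A. C \<alpha> \<ge> 0 \<and> (\<forall>r\<ge>1. \<forall>t x.
    \<bar>mpartial \<alpha> (osc (freq a \<xi> r) t \<phi>) x / r
      - \<phi> x * cos (freq a \<xi> r \<bullet> x + t + q) * xdir \<xi> \<alpha>\<bar> \<le> C \<alpha> * r powr (- m))"
    unfolding q_def
  proof (intro bchoice ballI)
    fix \<alpha> assume "\<alpha> \<in> A"
    from mpartial_osc[OF \<phi>(1) less_imp_le[OF m(1)] m(2) hom[OF this], of \<xi>] par[OF this]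
    show "\<exists>C\<ge>0. \<forall>r\<ge>1. \<forall>t x.
    \<bar>mpartial \<alpha> (osc (freq a \<xi> r) t \<phi>) x / r
      - \<phi> x * cos (freq a \<xi> r \<bullet> x + t + real p * (pi / 2)) * xdir \<xi> \<alpha>\<bar> \<le> C * r powr (- m)"
      by simp
  qed
  then obtain C where C: "\<And>\<alpha> r t x. \<alpha> \<in> A \<Longrightarrow> r \<ge> 1 \<Longrightarrow>
    \<bar>mpartial \<alpha> (osc (freq a \<xi> r) t \<phi>) x / r
      - \<phi> x * cos (freq a \<xi> r \<bullet> x + t + q) * xdir \<xi> \<alpha>\<bar> \<le> C \<alpha> * r powr (- m)"
    by blast
  define D where "D = K * (\<Sum>\<alpha>\<in>A. C \<alpha>)"
  have mc: "continuous_on S (\<lambda>y. mpartial \<alpha> f (h y))" "continuous_on S (\<lambda>y. \<phi> (h y))"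
    if "continuous_on S h" for S :: "'z::topological_space set" and h \<alpha>
    using that continuous_mpartial[OF sm(1)] smooth_differentiable[OF sm(2), THEN differentiable_imp_continuous_on]
    by (blast intro: continuous_on_compose2)+
  have gc: "continuous_on S (\<lambda>(t, x). g r t x)" for r S
    unfolding g_def split_def
    by (rule lip_continuous_on[OF L]) (intro continuous_intros mc)
  have gx: "continuous_on S (g r t)" for r t S
    unfolding g_def by (rule lip_continuous_on[OF L]) (intro continuous_intros mc)
  \<comment> \<open>The Lipschitz bound of \<open>G\<close> turns the error r^(-m) in the jet into
    at most \<open>D * r powr (- m)\<close> per unit volume.\<close>
  have lower: "0 \<le> integral (cbox u v) (g r t) + D * r powr (- m) * measure lborel (cbox u v)" if r: "r \<ge> 1" for r t
  proof -
    define F where "F x = f x + (1 / r) * osc (freq a \<xi> r) t \<phi> x" for x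
    have F0: "F x = 0" if "x \<notin> cbox u v" for x
      using f(2)[OF that] \<phi>(2)[OF that] by (simp add: F_def osc_def)
    have smF: "smooth F"
      unfolding F_def by (intro smooth_add smooth_mult smooth_const smooth_osc sm)
    have "F \<in> test_functions"
      by (rule test_functionsI[OF smF compact_cbox F0])
    then have "0 \<le> integral (cbox u v) (\<lambda>x. G (\<lambda>\<alpha>. mpartial \<alpha> F x))"
      using G F0 unfolding admissible_def by blast
    also have "\<dots> \<le> integral (cbox u v) (\<lambda>x. g r t x + D * r powr (- m))"
    proof (intro integral_le integrable_continuous lip_mpartial_continuous[OF L smF] continuous_intros gx)
      fix x
      have mF: "mpartial \<alpha> F x = mpartial \<alpha> f x + mpartial \<alpha> (osc (freq a \<xi> r) t \<phi>) x / r" for \<alpha>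
        unfolding F_def mpartial_eq_foldr
          foldr_partial_add[OF sm(1) smooth_mult[OF smooth_const smooth_osc[OF sm(2)]]]
          foldr_partial_cmult[OF smooth_osc[OF sm(2)]] by simp
      have "G (\<lambda>\<alpha>. mpartial \<alpha> F x) - g r t x \<le> K * (\<Sum>\<alpha>\<in>A. \<bar>mpartial \<alpha> F x
          - (mpartial \<alpha> f x + \<phi> x * cos (freq a \<xi> r \<bullet> x + t + q) * xdir \<xi> \<alpha>)\<bar>)"
        using L unfolding lip_def g_def by (meson abs_le_D1)
      also have "\<dots> \<le> K * (\<Sum>\<alpha>\<in>A. C \<alpha> * r powr (- m))"
        using C[OF _ r] by (intro mult_left_mono sum_mono K) (simp add: mF)
      finally show "G (\<lambda>\<alpha>. mpartial \<alpha> F x) \<le> g r t x + D * r powr (- m)"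
        by (simp add: D_def sum_distrib_left sum_distrib_right algebra_simps)
    qed
    also have "\<dots> = integral (cbox u v) (g r t) + D * r powr (- m) * measure lborel (cbox u v)"
      by (subst Henstock_Kurzweil_Integration.integral_add)
        (auto intro!: integrable_continuous gx)
    finally show ?thesis .
  qed
  have "0 \<le> ?I + D * r powr (- m) * measure lborel (cbox u v)" if r: "r \<ge> 1" for r
  proof -
    let ?E = "D * r powr (- m) * measure lborel (cbox u v)"
    have cont: "continuous_on UNIV (\<lambda>t. integral (cbox u v) (g r t))"
      by (rule integral_continuous_on_param) (rule gc)
    have "avg (\<lambda>t. 0) \<le> avg (\<lambda>t. integral (cbox u v) (g r t) + ?E)"
      by (intro avg_mono continuous_intros cont lower[OF r])
    also have "\<dots> = avg (\<lambda>t. integral (cbox u v) (g r t)) + ?E"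
      by (subst avg_add) (auto intro: cont simp: avg_const)
    also have "avg (\<lambda>t. integral (cbox u v) (g r t)) = integral (cbox u v) (\<lambda>x. integral {0..2 * pi} (\<lambda>t. g r t x)) / (2 * pi)"
      unfolding avg_def cbox_interval[symmetric] by (subst integral_swap_continuous) (auto intro: gc)
    also have "\<dots> = integral (cbox u v) (\<lambda>x. avg (\<lambda>t. g r t x))"
      by (simp add: avg_def)
    also have "(\<lambda>x. avg (\<lambda>t. g r t x)) = (\<lambda>x. line_avg G (xdir \<xi>) (\<phi> x) (\<lambda>\<alpha>. mpartial \<alpha> f x))"
    proof
      fix x
      have "continuous_on UNIV (\<lambda>s. G (\<lambda>\<alpha>. mpartial \<alpha> f x + \<phi> x * s * xdir \<xi> \<alpha>))"
        by (intro lip_continuous_on[OF L] continuous_intros)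
      \<comment> \<open>At a fixed point \<open>x\<close> the remaining phase is a mere shift in
        \<open>t\<close> and disappears from the average.\<close>
      from avg_cos_shift[OF this, of "freq a \<xi> r \<bullet> x + q"]
      show "avg (\<lambda>t. g r t x) = line_avg G (xdir \<xi>) (\<phi> x) (\<lambda>\<alpha>. mpartial \<alpha> f x)"
        by (simp add: g_def line_avg_def add_ac)
    qed
    finally show ?thesis by (simp add: avg_const)
  qed
  then have "\<forall>\<^sub>F r in at_top. 0 \<le> ?I + D * r powr (- m) * measure lborel (cbox u v)"
    using eventually_ge_at_top[of 1] by (rule eventually_mono[rotated])
  moreover have "((\<lambda>r. ?I + D * r powr (- m) * measure lborel (cbox u v)) \<longlongrightarrow> ?I + D * 0 * measure lborel (cbox u v)) at_top"
    using m(1) by (intro tendsto_intros tendsto_neg_powr filterlim_ident) auto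
  ultimately show ?thesis
    using tendsto_lowerbound[of _ _ at_top] by fastforce
qed

section \<open>Relaxation of admissible functions\<close>

text \<open>The open set is a countable union of open boxes, each with its bump. At a point of
  \<open>U\<close> some bump is positive, and its factor raised to the growing power
  \<open>n\<close> drives the product to 0; outside \<open>U\<close> all bumps vanish and the
  product is 1.\<close>

lemma test_functions_approx_open:
  fixes U :: "(real^'d::finite) set"
  assumes U: "open U" "U \<subseteq> cbox u v"
  obtains \<rho> :: "nat \<Rightarrow> real^'d \<Rightarrow> real"
  where "\<And>n. \<rho> n \<in> test_functions" "\<And>n x. x \<notin> U \<Longrightarrow> \<rho> n x = 0" "\<And>n x. \<bar>\<rho> n x\<bar> \<le> 1"
    "\<And>x. (\<lambda>n. \<rho> n x) \<longlonglongrightarrow> indicator U x"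
proof -
  obtain D where D: "countable D" "\<And>X. X \<in> D \<Longrightarrow> \<exists>a b. X = box a b" "\<Union>D = U"
    using open_countable_Union_open_box[OF U(1)] by metis
  \<comment> \<open>The empty set, itself a box, is added so that the enumeration makes sense even
    if \<open>D\<close> is empty.\<close>
  define X where "X = from_nat_into (insert {} D)"
  have rX: "range X = insert {} D"
    unfolding X_def using D(1) by (intro range_from_nat_into) auto
  have "{} = box (0 :: real^'d) 0" by simp
  then have "\<forall>n. \<exists>a b. X n = box a b"
    using D(2) rX by (metis insert_iff rangeI)
  then obtain a b where ab: "\<And>n. X n = box (a n) (b n)"
    by metis
  have UX: "(\<Union>n. box (a n) (b n)) = U"
    using rX D(3) by (auto simp flip: ab)
  define \<rho> where "\<rho> n x = 1 - (\<Prod>i\<le>n. (1 - bump (a i) (b i) x) ^ n)" for n x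
  have bnd: "0 \<le> (\<Prod>i\<in>I. (1 - bump (a i) (b i) x) ^ n)" "(\<Prod>i\<in>I. (1 - bump (a i) (b i) x) ^ n) \<le> 1" for n x I
    using bump_bounds by (auto intro!: prod_nonneg prod_le_1 zero_le_power power_le_one)
  have out: "\<rho> n x = 0" if "x \<notin> U" for n x
  proof -
    have "bump (a i) (b i) x = 0" for i
      using that UX bump_pos_iff[of "a i" "b i" x] bump_bounds(1)[of "a i" "b i" x] by fastforce
    then show ?thesis by (simp add: \<rho>_def)
  qed
  show thesis
  proof
    show "\<rho> n \<in> test_functions" for n
    proof (rule test_functionsI[of _ "cbox u v"])
      show "smooth (\<rho> n)"
        unfolding \<rho>_def by (intro smooth_diff smooth_const smooth_prod smooth_power smooth_bump)
    qed (use out U in auto)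
    show "\<rho> n x = 0" if "x \<notin> U" for n x by (rule out[OF that])
    show "\<bar>\<rho> n x\<bar> \<le> 1" for n x
      using bnd[where I = "{..n}" and x = x and n = n] by (simp add: \<rho>_def)
    show "(\<lambda>n. \<rho> n x) \<longlonglongrightarrow> indicator U x" for x
    proof (cases "x \<in> U")
      case True
      then obtain k where k: "x \<in> box (a k) (b k)"
        using UX by auto
      define q where "q = 1 - bump (a k) (b k) x"
      have q: "0 \<le> q" "q < 1"
        using bump_bounds[of "a k" "b k" x] bump_pos_iff[of "a k" "b k" x] k by (auto simp: q_def)
      have "(\<lambda>n. \<Prod>i\<le>n. (1 - bump (a i) (b i) x) ^ n) \<longlonglongrightarrow> 0"
      proof (rule Lim_null_comparison)
        show "(\<lambda>n. q ^ n) \<longlonglongrightarrow> 0"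
          using q by (intro LIMSEQ_realpow_zero) auto
        have "(\<Prod>i\<le>n. (1 - bump (a i) (b i) x) ^ n) \<le> q ^ n" if "n \<ge> k" for n
        proof -
          have "(\<Prod>i\<le>n. (1 - bump (a i) (b i) x) ^ n)
              = q ^ n * (\<Prod>i\<in>{..n} - {k}. (1 - bump (a i) (b i) x) ^ n)"
            unfolding q_def using that by (intro prod.remove) auto
          also have "\<dots> \<le> q ^ n * 1"
            using q bnd by (intro mult_left_mono) auto
          finally show ?thesis by simp
        qed
        then show "\<forall>\<^sub>F n in sequentially. norm (\<Prod>i\<le>n. (1 - bump (a i) (b i) x) ^ n) \<le> q ^ n"
          using bnd(1) by (auto simp: eventually_sequentially intro!: exI[of _ k])
      qed
      then have "(\<lambda>n. \<rho> n x) \<longlonglongrightarrow> 1 - 0"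
        unfolding \<rho>_def by (intro tendsto_intros)
      then show ?thesis using True by simp
    qed (simp add: out)
  qed
qed

lemma line_avg_continuous_on:
  assumes G: "lip A K G" and K: "K \<ge> 0"
    and \<phi>: "continuous_on S \<phi>" and v: "\<And>\<alpha>. \<alpha> \<in> A \<Longrightarrow> continuous_on S (\<lambda>z. v z \<alpha>)"
  shows "continuous_on S (\<lambda>z. line_avg G x (\<phi> z) (v z))"
  unfolding continuous_on_def
proof
  fix z assume z: "z \<in> S"
  let ?b = "\<lambda>y. K * ((\<Sum>\<alpha>\<in>A. \<bar>v y \<alpha> - v z \<alpha>\<bar>) + \<bar>\<phi> y - \<phi> z\<bar> * (\<Sum>\<alpha>\<in>A. \<bar>x \<alpha>\<bar>))"
  have "(?b \<longlongrightarrow> K * ((\<Sum>\<alpha>\<in>A. \<bar>v z \<alpha> - v z \<alpha>\<bar>) + \<bar>\<phi> z - \<phi> z\<bar> * (\<Sum>\<alpha>\<in>A. \<bar>x \<alpha>\<bar>))) (at z within S)"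
    using v \<phi> z unfolding continuous_on_def by (intro tendsto_intros) auto
  then have "(?b \<longlongrightarrow> 0) (at z within S)"
    by simp
  then have "((\<lambda>y. line_avg G x (\<phi> y) (v y) - line_avg G x (\<phi> z) (v z)) \<longlongrightarrow> 0) (at z within S)"
    by (rule Lim_null_comparison[rotated])
      (use line_avg_lip[OF G K] in \<open>auto intro!: always_eventually\<close>)
  then show "((\<lambda>y. line_avg G x (\<phi> y) (v y)) \<longlongrightarrow> line_avg G x (\<phi> z) (v z)) (at z within S)"
    by (simp add: LIM_zero_iff)
qed

locale anisotropic =
  fixes A :: "(nat^'d::finite) set" and a :: "real^'d" and m :: real and p :: nat
  assumes A: "finite A" and m: "0 < m" "\<And>i. m \<le> a $ i"
    and hom: "\<And>\<alpha>. \<alpha> \<in> A \<Longrightarrow> (\<Sum>i\<in>UNIV. real (\<alpha> $ i) * a $ i) = 1"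
    and par: "\<And>\<alpha>. \<alpha> \<in> A \<Longrightarrow> mdegree \<alpha> mod 2 = p"
begin

text \<open>The smooth amplitudes \<open>c * \<rho> n\<close> tend to \<open>c\<close> on
  \<open>U\<close> and to 0 elsewhere, where the average reduces to \<open>G\<close> itself.
  Dominated convergence carries the inequality over to the discontinuous amplitude.\<close>

lemma admissible_split:
  assumes G: "admissible A K G" and K: "K \<ge> 0"
    and f: "f \<in> test_functions" "\<And>x. x \<notin> cbox u v \<Longrightarrow> f x = 0"
    and U: "open U" "U \<subseteq> cbox u v"
  shows "0 \<le> integral (cbox u v) (\<lambda>x. if x \<in> U then line_avg G (xdir \<xi>) c (\<lambda>\<alpha>. mpartial \<alpha> f x)
    else G (\<lambda>\<alpha>. mpartial \<alpha> f x))"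
proof -
  have L: "lip A K G" using G by (simp add: admissible_def)
  have sf: "smooth f" using f test_functions_smooth by auto
  obtain \<rho> :: "nat \<Rightarrow> real^'d \<Rightarrow> real" where \<rho>: "\<And>n. \<rho> n \<in> test_functions" "\<And>n x. x \<notin> U \<Longrightarrow> \<rho> n x = 0"
      "\<And>n x. \<bar>\<rho> n x\<bar> \<le> 1" "\<And>x. (\<lambda>n. \<rho> n x) \<longlonglongrightarrow> indicator U x"
    using test_functions_approx_open[OF U] by blast
  define h where "h n x = line_avg G (xdir \<xi>) (c * \<rho> n x) (\<lambda>\<alpha>. mpartial \<alpha> f x)" for n x
  define B where "B x = K * ((\<Sum>\<alpha>\<in>A. \<bar>mpartial \<alpha> f x - 0\<bar>) + \<bar>c\<bar> * (\<Sum>\<alpha>\<in>A. \<bar>xdir \<xi> \<alpha>\<bar>))" for x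
  have nonneg: "0 \<le> integral (cbox u v) (h n)" for n
    unfolding h_def
  proof (rule admissible_line_avg[OF A m hom par G K f])
    have "smooth (\<lambda>x. c * \<rho> n x)"
      by (intro smooth_mult smooth_const test_functions_smooth \<rho>)
    then show "(\<lambda>x. c * \<rho> n x) \<in> test_functions"
      by (rule test_functionsI[OF _ compact_cbox[of u v]]) (use \<rho>(2) U(2) in auto)
    show "c * \<rho> n x = 0" if "x \<notin> cbox u v" for x
      using \<rho>(2) U(2) that by auto
  qed
  have conv: "(\<lambda>n. integral (cbox u v) (h n)) \<longlonglongrightarrow> integral (cbox u v) (\<lambda>x. if x \<in> U
      then line_avg G (xdir \<xi>) c (\<lambda>\<alpha>. mpartial \<alpha> f x) else G (\<lambda>\<alpha>. mpartial \<alpha> f x))"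
  proof (rule dominated_convergence(2)[where h = B])
    have "continuous_on S (\<rho> n)" for n S
      using smooth_differentiable[OF test_functions_smooth[OF \<rho>(1)], THEN differentiable_imp_continuous_on]
      by (meson continuous_on_subset subset_UNIV)
    then show "h n integrable_on cbox u v" for n
      unfolding h_def
      by (intro integrable_continuous line_avg_continuous_on[OF L K] continuous_intros continuous_mpartial[OF sf])
    show "B integrable_on cbox u v"
      unfolding B_def by (intro integrable_continuous continuous_intros continuous_mpartial[OF sf])
    show "norm (h n x) \<le> B x" for n x
    proof -
      have "line_avg G (xdir \<xi>) 0 (\<lambda>_. 0) = 0"
        using G by (simp add: line_avg_zero admissible_def)
      then have "\<bar>h n x\<bar> \<le> K * ((\<Sum>\<alpha>\<in>A. \<bar>mpartial \<alpha> f x - 0\<bar>) + \<bar>c * \<rho> n x - 0\<bar> * (\<Sum>\<alpha>\<in>A. \<bar>xdir \<xi> \<alpha>\<bar>))"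
        using line_avg_lip[OF L K, of "xdir \<xi>" "c * \<rho> n x" "\<lambda>\<alpha>. mpartial \<alpha> f x" 0 "\<lambda>_. 0"]
        by (simp add: h_def)
      also have "\<dots> \<le> B x"
        unfolding B_def using \<rho>(3)[of n x]
        by (intro mult_left_mono add_left_mono mult_right_mono K sum_nonneg)
          (auto simp: abs_mult intro: mult_left_le)
      finally show ?thesis by simp
    qed
    fix x
    have "continuous_on UNIV (\<lambda>s. line_avg G (xdir \<xi>) s (\<lambda>\<alpha>. mpartial \<alpha> f x))"
      by (intro line_avg_continuous_on[OF L K] continuous_intros)
    moreover have "(\<lambda>n. c * \<rho> n x) \<longlonglongrightarrow> c * indicator U x"
      by (intro tendsto_intros \<rho>)
    ultimately have "(\<lambda>n. h n x) \<longlonglongrightarrow> line_avg G (xdir \<xi>) (c * indicator U x) (\<lambda>\<alpha>. mpartial \<alpha> f x)"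
      unfolding h_def by (rule continuous_on_tendsto_compose) auto
    then show "(\<lambda>n. h n x) \<longlonglongrightarrow> (if x \<in> U
      then line_avg G (xdir \<xi>) c (\<lambda>\<alpha>. mpartial \<alpha> f x) else G (\<lambda>\<alpha>. mpartial \<alpha> f x))"
      by (cases "x \<in> U") (simp_all add: line_avg_zero)
  qed
  show ?thesis
    by (rule tendsto_lowerbound[OF conv]) (auto simp: nonneg)
qed

lemma mpartial_zero: "mpartial \<alpha> (\<lambda>_. 0) x = 0"
  unfolding mpartial_eq_foldr by (rule foldr_partial_vanish[of UNIV]) auto

text \<open>For the zero test function and the open unit box as \<open>U\<close>, the integral is
  the average itself. This is what keeps the value 0 at 0 under relaxation.\<close>

lemma line_avg_nonneg_at_0:
  assumes G: "admissible A K G" and K: "K \<ge> 0"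
  shows "0 \<le> line_avg G (xdir \<xi>) c (\<lambda>_. 0)"
proof -
  let ?k = "line_avg G (xdir \<xi>) c (\<lambda>_. 0)"
  have "(\<lambda>x::real^'d. 0) \<in> test_functions"
    by (intro test_functionsI[of _ "{}"] smooth_const) auto
  from admissible_split[OF G K this _ open_box box_subset_cbox, of 0 One \<xi> c]
  have "0 \<le> integral (cbox 0 One) (\<lambda>x::real^'d. if x \<in> box 0 One then ?k else 0)"
    using G by (simp add: mpartial_zero admissible_def cong: if_cong)
  also have "\<dots> = integral (box 0 One) (\<lambda>x::real^'d. ?k)"
    by (subst integral_restrict_Int) (simp add: inf.absorb1 box_subset_cbox)
  also have "\<dots> = ?k"
    by (simp add: integral_open_interval integral_const content_unit)
  finally show ?thesis .
qed

definition relax :: "real^'d \<Rightarrow> real \<Rightarrow> ((nat^'d \<Rightarrow> real) \<Rightarrow> real) \<Rightarrow> (nat^'d \<Rightarrow> real) \<Rightarrow> real" where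
  "relax \<xi> c G e = min (G e) (line_avg G (xdir \<xi>) c e)"

lemma lip_relax:
  assumes "lip A K G" "K \<ge> 0"
  shows "lip A K (relax \<xi> c G)"
  using assms(1) lip_line_avg[OF assms, of "xdir \<xi>" c] unfolding lip_def relax_def
  by (smt (verit, best))

text \<open>The amplitude \<open>c\<close> is switched on exactly where the average is strictly
  below \<open>G\<close>, which turns the split integrand into the minimum. This set is open by
  continuity, and it stays inside the box because the jet is 0 outside and the average at 0 is
  nonnegative.\<close>

lemma admissible_relax:
  assumes G: "admissible A K G" and K: "K \<ge> 0"
  shows "admissible A K (relax \<xi> c G)"
  unfolding admissible_def
proof (intro conjI ballI allI impI)
  have L: "lip A K G" using G by (simp add: admissible_def)
  show "lip A K (relax \<xi> c G)"
    by (rule lip_relax[OF L K])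
  show "relax \<xi> c G (\<lambda>_. 0) = 0"
    using G line_avg_nonneg_at_0[OF G K] by (simp add: relax_def admissible_def)
  fix f :: "real^'d \<Rightarrow> real" and u v
  assume f: "f \<in> test_functions" "\<forall>x. x \<notin> cbox u v \<longrightarrow> f x = 0"
  let ?D = "\<lambda>x \<alpha>. mpartial \<alpha> f x"
  define U where "U = {x. line_avg G (xdir \<xi>) c (?D x) < G (?D x)}"
  have D0: "?D x = (\<lambda>_. 0)" if "x \<notin> cbox u v" for x
    unfolding mpartial_eq_foldr
    by (rule ext, rule foldr_partial_vanish[of "- cbox u v"]) (use that f in auto)
  have "U \<subseteq> cbox u v"
  proof (rule subsetI, rule ccontr)
    fix x assume "x \<in> U" "x \<notin> cbox u v"
    then have "line_avg G (xdir \<xi>) c (\<lambda>_. 0) < G (\<lambda>_. 0)"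
      by (simp add: U_def D0)
    then show False
      using line_avg_nonneg_at_0[OF G K, of \<xi> c] G by (simp add: admissible_def)
  qed
  moreover have "open U"
    unfolding U_def
    by (intro open_Collect_less line_avg_continuous_on[OF L K] lip_continuous_on[OF L]
      continuous_on_const continuous_mpartial test_functions_smooth f)
  ultimately have "0 \<le> integral (cbox u v) (\<lambda>x. if x \<in> U then line_avg G (xdir \<xi>) c (?D x) else G (?D x))"
    using f by (intro admissible_split[OF G K]) auto
  also have "(\<lambda>x. if x \<in> U then line_avg G (xdir \<xi>) c (?D x) else G (?D x)) = (\<lambda>x. relax \<xi> c G (?D x))"
    by (auto simp: U_def relax_def)
  finally show "0 \<le> integral (cbox u v) (\<lambda>x. relax \<xi> c G (?D x))" .
qed

end

section \<open>Directionally convex homogeneous functions\<close>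

lemma avg_cos: "avg cos = 0"
proof -
  have "continuous_on UNIV (\<lambda>t::real. t)"
    by (intro continuous_intros)
  from avg_cos_shift[OF this, of pi] have "avg (\<lambda>t. - 1 * cos t) = avg cos"
    by simp
  then show ?thesis
    unfolding avg_cmult by simp
qed

lemma avg_cos_squared: "avg (\<lambda>t. (cos t)\<^sup>2) = 1 / 2"
proof -
  have "continuous_on UNIV (\<lambda>t::real. t\<^sup>2)"
    by (intro continuous_intros)
  from avg_cos_shift[OF this, of "pi / 2"] have "avg (\<lambda>t. (sin t)\<^sup>2) = avg (\<lambda>t. (cos t)\<^sup>2)"
    by (simp add: cos_add)
  moreover have "avg (\<lambda>t. (sin t)\<^sup>2) + avg (\<lambda>t. (cos t)\<^sup>2) = avg (\<lambda>t. (sin t)\<^sup>2 + (cos t)\<^sup>2)"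
    by (intro avg_add[symmetric] continuous_intros)
  ultimately show ?thesis
    by (simp add: avg_const)
qed

text \<open>The maximum principle: subtracting from a would-be violation of convexity the chord and a small
  parabola leaves an interior maximum, where the averages are strictly too small.\<close>

lemma convex_on_if_submean:
  fixes g :: "real \<Rightarrow> real"
  assumes cont: "continuous_on UNIV g" and sub: "\<And>r c. g r \<le> avg (\<lambda>t. g (r + c * cos t))"
  shows "convex_on UNIV g"
proof (rule convex_on_linorderI)
  fix t a b :: real
  assume t: "0 < t" "t < 1" and ab: "a < b"
  define y where "y = (1 - t) * a + t * b"
  define k where "k = (g b - g a) / (b - a)"
  have y: "y - a = t * (b - a)" "b - y = (1 - t) * (b - a)"
    by (auto simp: y_def algebra_simps)
  have ya: "y > a" "y < b"
    using y t ab by (smt (verit) mult_pos_pos)+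
  show "g ((1 - t) *\<^sub>R a + t *\<^sub>R b) \<le> (1 - t) * g a + t * g b"
  proof (rule ccontr)
    assume neg: "\<not> ?thesis"
    have kab: "k * (b - a) = g b - g a"
      using ab by (simp add: k_def)
    have "(1 - t) * g a + t * g b = g a + t * (k * (b - a))"
      unfolding kab by (simp add: algebra_simps)
    also have "\<dots> = g a + (y - a) * k"
      by (simp add: y)
    finally have pos: "g y - (g a + (y - a) * k) > 0"
      using neg by (simp add: y_def)
    define d where "d = g y - (g a + (y - a) * k)"
    define P where "P = (y - a) * (b - y)"
    \<comment> \<open>Chosen so that the parabola removes only half of the excess \<open>d\<close>
      at \<open>y\<close>, which keeps \<psi> positive there.\<close>
    define \<epsilon> where "\<epsilon> = d / (2 * P)"
    have P: "P > 0"
      using ya by (simp add: P_def)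
    have \<epsilon>: "\<epsilon> > 0" "\<epsilon> * P = d / 2"
      using pos P by (auto simp: \<epsilon>_def simp flip: d_def)
    define \<psi> where "\<psi> r = g r - (g a + (r - a) * k) + \<epsilon> * ((r - a) * (r - b))" for r
    have "continuous_on {a..b} \<psi>"
      unfolding \<psi>_def by (intro continuous_intros continuous_on_subset[OF cont]) auto
    then obtain z where z: "z \<in> {a..b}" "\<And>r. r \<in> {a..b} \<Longrightarrow> \<psi> r \<le> \<psi> z"
      using continuous_attains_sup[of "{a..b}" \<psi>] ab by (auto simp: compact_Icc)
    have "\<psi> y = d - \<epsilon> * P"
      by (simp add: \<psi>_def d_def P_def algebra_simps)
    then have "\<psi> y > 0"
      using \<epsilon>(2) pos by (simp flip: d_def)
    then have "\<psi> z > 0"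
      using z(2)[of y] ya by auto
    moreover have "\<psi> a = 0" "\<psi> b = 0"
      using kab by (auto simp: \<psi>_def algebra_simps)
    ultimately have zab: "a < z" "z < b"
      using z(1) by (auto simp: less_le)
    \<comment> \<open>The largest amplitude for which \<open>z + c * cos t\<close> stays in the
      interval on which \<psi> is maximal at \<open>z\<close>.\<close>
    define c where "c = min (z - a) (b - z)"
    have c: "c > 0" using zab by (simp add: c_def)
    \<comment> \<open>Collects the coefficients of \<open>cos t\<close>, whose average is 0; only
      the quadratic term survives averaging, and it is negative.\<close>
    define q where "q = k * c - \<epsilon> * c * (2 * z - a - b)"
    have bound: "g (z + c * cos t) \<le> (g z + q * cos t) + (- (\<epsilon> * c\<^sup>2)) * (cos t)\<^sup>2" for t
    proof -
      have "\<bar>c * cos t\<bar> \<le> c"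
        using c by (simp add: abs_mult mult_left_le)
      then have "z + c * cos t \<in> {a..b}"
        unfolding c_def by (auto simp: abs_le_iff min_def split: if_splits)
      from z(2)[OF this] show ?thesis
        by (simp add: \<psi>_def q_def algebra_simps power2_eq_square)
    qed
    have "g z \<le> avg (\<lambda>t. g (z + c * cos t))"
      by (rule sub)
    also have "\<dots> \<le> avg (\<lambda>t. (g z + q * cos t) + (- (\<epsilon> * c\<^sup>2)) * (cos t)\<^sup>2)"
      by (intro avg_mono bound continuous_intros continuous_on_compose2[OF cont]) auto
    also have "\<dots> = g z - \<epsilon> * c\<^sup>2 / 2"
    proof -
      have "avg (\<lambda>t. (g z + q * cos t) + (- (\<epsilon> * c\<^sup>2)) * (cos t)\<^sup>2)
          = avg (\<lambda>t. g z + q * cos t) + avg (\<lambda>t. (- (\<epsilon> * c\<^sup>2)) * (cos t)\<^sup>2)"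
        by (intro avg_add continuous_intros)
      moreover have "avg (\<lambda>t. g z + q * cos t) = avg (\<lambda>t. g z) + avg (\<lambda>t. q * cos t)"
        by (intro avg_add continuous_intros)
      ultimately show ?thesis
        unfolding avg_cmult avg_const avg_cos avg_cos_squared by simp
    qed
    finally have "\<epsilon> * c\<^sup>2 \<le> 0" by simp
    moreover have "\<epsilon> * c\<^sup>2 > 0"
      using \<epsilon>(1) c by simp
    ultimately show False by simp
  qed
qed simp

text \<open>Kirchheim and Kristensen: the linear minorant is obtained by pushing the argument to infinity
  along one direction after the other, each step keeping the linearity already achieved.\<close>

definition dir_convex :: "'a set \<Rightarrow> real \<Rightarrow> ('a \<Rightarrow> real) set \<Rightarrow> (('a \<Rightarrow> real) \<Rightarrow> real) \<Rightarrow> bool" where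
  "dir_convex A K D V \<longleftrightarrow> lip A K V \<and> (\<forall>r>0. \<forall>e. V (\<lambda>\<alpha>. r * e \<alpha>) = r * V e) \<and>
    (\<forall>x\<in>D. \<forall>e. convex_on UNIV (\<lambda>r. V (\<lambda>\<alpha>. e \<alpha> + r * x \<alpha>)))"

text \<open>The slope \<open>c\<close> is the same on all lines parallel to \<open>x\<close>, so
  linearity along several directions adds up to affinity on their span.\<close>

definition linear_along :: "('a \<Rightarrow> real) \<Rightarrow> (('a \<Rightarrow> real) \<Rightarrow> real) \<Rightarrow> bool" where
  "linear_along x V \<longleftrightarrow> (\<exists>c. \<forall>e r. V (\<lambda>\<alpha>. e \<alpha> + r * x \<alpha>) = V e + r * c)"

lemma lip_const_nonneg:
  assumes "lip A K V" "V (\<lambda>_. 0) = 0"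
  shows "V e \<le> K * (\<Sum>\<alpha>\<in>A. \<bar>e \<alpha>\<bar>)" "V e \<ge> - (K * (\<Sum>\<alpha>\<in>A. \<bar>e \<alpha>\<bar>))"
proof -
  have "\<bar>V e - V (\<lambda>_. 0)\<bar> \<le> K * (\<Sum>\<alpha>\<in>A. \<bar>e \<alpha> - 0\<bar>)"
    using assms(1) unfolding lip_def by blast
  then show "V e \<le> K * (\<Sum>\<alpha>\<in>A. \<bar>e \<alpha>\<bar>)" "V e \<ge> - (K * (\<Sum>\<alpha>\<in>A. \<bar>e \<alpha>\<bar>))"
    using assms(2) by auto
qed

text \<open>\<open>W e\<close> is the limit of V(e + s x) - s V(x) as s tends to infinity. By
  homogeneity and the Lipschitz bound, \<open>V x\<close> is the asymptotic slope on every line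
  parallel to \<open>x\<close>; convexity bounds all slopes by it, so the difference decreases in s
  and its limit is a minorant. Such limits preserve the Lipschitz bound, homogeneity, convexity and
  the linearity already present.\<close>

lemma dir_convex_linearize:
  assumes V: "dir_convex A K D V" and x: "x \<in> D"
  obtains W where "dir_convex A K D W" "\<And>e. W e \<le> V e" "linear_along x W"
    "\<And>y. linear_along y V \<Longrightarrow> linear_along y W"
proof -
  have L: "\<bar>V e - V e'\<bar> \<le> K * (\<Sum>\<alpha>\<in>A. \<bar>e \<alpha> - e' \<alpha>\<bar>)" for e e'
    using V by (simp add: dir_convex_def lip_def)
  have H: "V (\<lambda>\<alpha>. r * e \<alpha>) = r * V e" if "r > 0" for r e
    using V that by (simp add: dir_convex_def)
  have C: "convex_on UNIV (\<lambda>r. V (\<lambda>\<alpha>. e \<alpha> + r * y \<alpha>))" if "y \<in> D" for y e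
    using V that by (simp add: dir_convex_def)
  define N where "N e = K * (\<Sum>\<alpha>\<in>A. \<bar>e \<alpha>\<bar>)" for e
  define h where "h e s = V (\<lambda>\<alpha>. e \<alpha> + s * x \<alpha>) - s * V x" for e s
  \<comment> \<open>\<open>s * V x\<close> is the value of \<open>V\<close> at s x, and this point
    differs from e + s x by \<open>e\<close>, independently of s.\<close>
  have near: "\<bar>h e s\<bar> \<le> N e" if "s > 0" for e s
    using L[of "\<lambda>\<alpha>. e \<alpha> + s * x \<alpha>" "\<lambda>\<alpha>. s * x \<alpha>"] H[OF that, of x] by (simp add: h_def N_def)
  have anti: "h e s2 \<le> h e s1" if s: "s1 < s2" for e s1 s2
  proof -
    define g where "g r = V (\<lambda>\<alpha>. e \<alpha> + r * x \<alpha>)" for r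
    \<comment> \<open>Convexity compares the increment with the chord from \<open>s1\<close> to a
      far point \<open>S\<close>, whose slope is bounded by a quantity tending to \<open>V x\<close>
      as \<open>S\<close> grows.\<close>
    have "g s2 - g s1 \<le> (s2 - s1) * (V x + (N e - g s1 + s1 * V x) / (S - s1))" if S: "S > max s2 0" for S
    proof -
      define t where "t = (s2 - s1) / (S - s1)"
      have t: "0 \<le> t" "t \<le> 1" "t * (S - s1) = s2 - s1"
        using s S by (auto simp: t_def)
      have s2: "(1 - t) * s1 + t * S = s2"
        using t(3) by (simp add: algebra_simps)
      have "g ((1 - t) * s1 + t * S) \<le> (1 - t) * g s1 + t * g S"
        using convex_onD[OF C[OF x, of e] t(1,2), of s1 S] by (simp add: g_def)
      then have "g s2 - g s1 \<le> t * (g S - g s1)"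
        unfolding s2 by (simp add: algebra_simps)
      also have "\<dots> \<le> t * (S * V x + N e - g s1)"
        using near[of S e] S t by (intro mult_left_mono) (auto simp: h_def g_def)
      also have "\<dots> = (s2 - s1) * (V x + (N e - g s1 + s1 * V x) / (S - s1))"
        using s S by (simp add: t_def field_simps)
      finally show ?thesis .
    qed
    then have "\<forall>\<^sub>F S in at_top. g s2 - g s1 \<le> (s2 - s1) * (V x + (N e - g s1 + s1 * V x) / (S - s1))"
      using eventually_gt_at_top by (rule eventually_mono[rotated])
    moreover have "((\<lambda>S. (s2 - s1) * (V x + (N e - g s1 + s1 * V x) / (S - s1))) \<longlongrightarrow> (s2 - s1) * (V x + 0)) at_top"
    proof (intro tendsto_intros tendsto_divide_0[OF tendsto_const] filterlim_at_top_imp_at_infinity)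
      show "filterlim (\<lambda>S. S - s1) at_top at_top"
        using filterlim_tendsto_add_at_top[OF tendsto_const filterlim_ident, of "- s1"] by simp
    qed
    ultimately have "g s2 - g s1 \<le> (s2 - s1) * (V x + 0)"
      using tendsto_lowerbound trivial_limit_at_top_linorder by blast
    then show ?thesis
      by (simp add: h_def g_def algebra_simps)
  qed
  have low: "- N e \<le> h e s" for e s
  proof -
    have "- N e \<le> h e (max s 1)"
      using near[of "max s 1" e] by (auto simp: abs_le_iff less_max_iff_disj)
    also have "\<dots> \<le> h e s"
      using anti[of s 1 e] by (cases "s < 1") (auto simp: max_def)
    finally show ?thesis .
  qed
  define W where "W e = (INF s. h e s)" for e
  have bdd: "bdd_below (range (h e))" for e
    using low by (intro bdd_belowI) auto
  have lim: "(h e \<longlongrightarrow> W e) at_top" for e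
  proof (rule order_tendstoI)
    fix y assume "y < W e"
    then show "\<forall>\<^sub>F s in at_top. y < h e s"
      unfolding W_def using cINF_lower[OF bdd] by (intro always_eventually allI) (metis UNIV_I less_le_trans)
  next
    fix y assume "W e < y"
    then obtain s where "h e s < y"
      unfolding W_def using cINF_less_iff[OF _ bdd] by auto
    then show "\<forall>\<^sub>F s in at_top. h e s < y"
      by (intro eventually_mono[OF eventually_gt_at_top[of s]]) (meson anti le_less_trans)
  qed
  have nontriv: "(at_top :: real filter) \<noteq> bot" by simp
  show thesis
  proof
    show "W e \<le> V e" for e
      using cINF_lower[OF bdd, of 0 e] by (simp add: W_def h_def)
    show "linear_along y W" if y: "linear_along y V" for y
    proof -
      obtain c where c: "\<And>e r. V (\<lambda>\<alpha>. e \<alpha> + r * y \<alpha>) = V e + r * c"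
        using y by (auto simp: linear_along_def)
      have "W (\<lambda>\<alpha>. e \<alpha> + r * y \<alpha>) = W e + r * c" for e r
      proof (rule tendsto_unique[OF nontriv lim])
        have "h (\<lambda>\<alpha>. e \<alpha> + r * y \<alpha>) = (\<lambda>s. h e s + r * c)"
          using c[of "\<lambda>\<alpha>. e \<alpha> + s * x \<alpha>" r for s] by (simp add: h_def fun_eq_iff algebra_simps)
        then show "(h (\<lambda>\<alpha>. e \<alpha> + r * y \<alpha>) \<longlongrightarrow> W e + r * c) at_top"
          by (simp add: tendsto_add[OF lim tendsto_const])
      qed
      then show ?thesis by (auto simp: linear_along_def)
    qed
    show "linear_along x W"
    proof -
      have "W (\<lambda>\<alpha>. e \<alpha> + r * x \<alpha>) = W e + r * V x" for e r
      proof (rule tendsto_unique[OF nontriv lim])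
        \<comment> \<open>Moving \<open>e\<close> along \<open>x\<close> only shifts the parameter
          s, so \<open>W\<close> has slope \<open>V x\<close> along \<open>x\<close>.\<close>
        have "h (\<lambda>\<alpha>. e \<alpha> + r * x \<alpha>) = (\<lambda>s. h e (s + r) + r * V x)"
          by (simp add: h_def fun_eq_iff algebra_simps)
        moreover have "((\<lambda>s. h e (s + r)) \<longlongrightarrow> W e) at_top"
        proof (rule filterlim_compose[OF lim])
          show "filterlim (\<lambda>s. s + r) at_top at_top"
            using filterlim_tendsto_add_at_top[OF tendsto_const filterlim_ident, of r] by (simp add: add.commute)
        qed
        ultimately show "(h (\<lambda>\<alpha>. e \<alpha> + r * x \<alpha>) \<longlongrightarrow> W e + r * V x) at_top"
          by (simp add: tendsto_add[OF _ tendsto_const])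
      qed
      then show ?thesis by (auto simp: linear_along_def)
    qed
    show "dir_convex A K D W"
      unfolding dir_convex_def
    proof (intro conjI allI impI ballI)
      show "lip A K W"
        unfolding lip_def
      proof (intro allI)
        fix e e'
        have "\<bar>h e s - h e' s\<bar> \<le> K * (\<Sum>\<alpha>\<in>A. \<bar>e \<alpha> - e' \<alpha>\<bar>)" for s
          using L[of "\<lambda>\<alpha>. e \<alpha> + s * x \<alpha>" "\<lambda>\<alpha>. e' \<alpha> + s * x \<alpha>"] by (simp add: h_def)
        then show "\<bar>W e - W e'\<bar> \<le> K * (\<Sum>\<alpha>\<in>A. \<bar>e \<alpha> - e' \<alpha>\<bar>)"
          by (intro tendsto_upperbound[OF tendsto_rabs[OF tendsto_diff[OF lim lim]]]) auto
      qed
      show "W (\<lambda>\<alpha>. r * e \<alpha>) = r * W e" if r: "r > 0" for r e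
      proof (rule tendsto_unique[OF nontriv])
        have "filterlim (\<lambda>s. r * s) at_top at_top"
          using r filterlim_tendsto_pos_mult_at_top[OF tendsto_const _ filterlim_ident] by blast
        from filterlim_compose[OF lim this]
        show "((\<lambda>s. h (\<lambda>\<alpha>. r * e \<alpha>) (r * s)) \<longlongrightarrow> W (\<lambda>\<alpha>. r * e \<alpha>)) at_top" .
        have "h (\<lambda>\<alpha>. r * e \<alpha>) (r * s) = r * h e s" for s
          using H[OF r, of "\<lambda>\<alpha>. e \<alpha> + s * x \<alpha>"] by (simp add: h_def algebra_simps)
        then show "((\<lambda>s. h (\<lambda>\<alpha>. r * e \<alpha>) (r * s)) \<longlongrightarrow> r * W e) at_top"
          by (simp add: tendsto_mult[OF tendsto_const lim])
      qed
      show "convex_on UNIV (\<lambda>r. W (\<lambda>\<alpha>. e \<alpha> + r * y \<alpha>))" if y: "y \<in> D" for y e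
      proof (rule convex_onI)
        fix t a b :: real
        assume t: "0 < t" "t < 1"
        define p where "p r = (\<lambda>\<alpha>. e \<alpha> + r * y \<alpha>)" for r
        have "h (p ((1 - t) * a + t * b)) s \<le> (1 - t) * h (p a) s + t * h (p b) s" for s
        proof -
          have swap: "(\<lambda>\<alpha>. p r \<alpha> + s * x \<alpha>) = (\<lambda>\<alpha>. (e \<alpha> + s * x \<alpha>) + r * y \<alpha>)" for r
            by (auto simp: p_def)
          show ?thesis
            using convex_onD[OF C[OF y, of "\<lambda>\<alpha>. e \<alpha> + s * x \<alpha>"], of t a b] t
            unfolding h_def swap by (simp add: algebra_simps)
        qed
        then have "W (p ((1 - t) * a + t * b)) \<le> (1 - t) * W (p a) + t * W (p b)"
          by (intro tendsto_le[OF nontriv tendsto_add[OF tendsto_mult[OF tendsto_const lim] tendsto_mult[OF tendsto_const lim]] lim]) auto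
        then show "W (\<lambda>\<alpha>. e \<alpha> + ((1 - t) *\<^sub>R a + t *\<^sub>R b) * y \<alpha>)
            \<le> (1 - t) * W (\<lambda>\<alpha>. e \<alpha> + a * y \<alpha>) + t * W (\<lambda>\<alpha>. e \<alpha> + b * y \<alpha>)"
          by (simp add: p_def)
      qed simp
    qed
  qed
qed

text \<open>Linearizing along the finitely many directions one at a time gives a minorant
  \<open>W\<close> that is linear on their span, hence odd there; \<open>V\<close> is at least
  \<open>W\<close> at both points.\<close>

lemma dir_convex_opposite:
  assumes V: "dir_convex A K D V" and I: "finite I" "\<And>i. i \<in> I \<Longrightarrow> x i \<in> D"
  shows "0 \<le> V (\<lambda>\<alpha>. \<Sum>i\<in>I. r i * x i \<alpha>) + V (\<lambda>\<alpha>. - (\<Sum>i\<in>I. r i * x i \<alpha>))"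
proof -
  have "\<exists>W. dir_convex A K D W \<and> (\<forall>e. W e \<le> V e) \<and> (\<forall>i\<in>I. linear_along (x i) W)"
    using I
  proof (induction I rule: finite_induct)
    case empty
    then show ?case using V by auto
  next
    case (insert j I)
    then obtain W where W: "dir_convex A K D W" "\<And>e. W e \<le> V e" "\<And>i. i \<in> I \<Longrightarrow> linear_along (x i) W"
      by auto
    obtain W' where "dir_convex A K D W'" "\<And>e. W' e \<le> W e" "linear_along (x j) W'"
        "\<And>y. linear_along y W \<Longrightarrow> linear_along y W'"
      using dir_convex_linearize[OF W(1), of "x j"] insert.prems by auto
    then show ?case
      using W by (intro exI[of _ W']) (auto intro: order_trans)
  qed
  then obtain W where W: "dir_convex A K D W" "\<And>e. W e \<le> V e" "\<And>i. i \<in> I \<Longrightarrow> linear_along (x i) W"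
    by blast
  obtain c where c: "\<And>i e s. i \<in> I \<Longrightarrow> W (\<lambda>\<alpha>. e \<alpha> + s * x i \<alpha>) = W e + s * c i"
    using W(3) unfolding linear_along_def by metis
  have sum: "W (\<lambda>\<alpha>. \<Sum>i\<in>J. s i * x i \<alpha>) = W (\<lambda>_. 0) + (\<Sum>i\<in>J. s i * c i)" if "J \<subseteq> I" for J s
    using finite_subset[OF that I(1)] that
  proof (induction J rule: finite_induct)
    case (insert j J)
    then show ?case
      using c[of j "\<lambda>\<alpha>. \<Sum>i\<in>J. s i * x i \<alpha>" "s j"] by (simp add: add_ac)
  qed auto
  \<comment> \<open>Homogeneity with factor 2 says that the value at 0 equals its double.\<close>
  have "W (\<lambda>_. 0) = 0"
    using W(1)[unfolded dir_convex_def, THEN conjunct2, THEN conjunct1, rule_format, of 2 "\<lambda>_. 0"] by simp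
  then have "W (\<lambda>\<alpha>. \<Sum>i\<in>I. r i * x i \<alpha>) + W (\<lambda>\<alpha>. - (\<Sum>i\<in>I. r i * x i \<alpha>)) = 0"
    using sum[of I r] sum[of I "\<lambda>i. - r i"] by (simp add: sum_negf)
  then show ?thesis
    using add_mono[OF W(2) W(2), of "\<lambda>\<alpha>. \<Sum>i\<in>I. r i * x i \<alpha>" "\<lambda>\<alpha>. - (\<Sum>i\<in>I. r i * x i \<alpha>)"]
    by linarith
qed

section \<open>The envelope of all relaxations\<close>

context anisotropic
begin

inductive_set relaxations :: "((nat^'d \<Rightarrow> real) \<Rightarrow> real) \<Rightarrow> ((nat^'d \<Rightarrow> real) \<Rightarrow> real) set" for F where
  base: "F \<in> relaxations F"
| step: "G \<in> relaxations F \<Longrightarrow> relax \<xi> c G \<in> relaxations F"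

lemma relax_le: "relax \<xi> c G e \<le> G e"
  by (simp add: relax_def)

lemma relax_mono:
  assumes "lip A K G" "lip A K H" "\<And>e. G e \<le> H e"
  shows "relax \<xi> c G e \<le> relax \<xi> c H e"
  unfolding relax_def by (intro min.mono line_avg_mono[OF assms] assms(3))

definition envelope :: "((nat^'d \<Rightarrow> real) \<Rightarrow> real) \<Rightarrow> (nat^'d \<Rightarrow> real) \<Rightarrow> real" where
  "envelope F e = (INF G\<in>relaxations F. G e)"

context
  fixes F :: "(nat^'d \<Rightarrow> real) \<Rightarrow> real" and K :: real
  assumes F: "admissible A K F" and K: "K \<ge> 0"
    and F_scale: "\<And>r e. r > 0 \<Longrightarrow> F (\<lambda>\<alpha>. r * e \<alpha>) = r * F e"
begin

lemma relaxations_admissible: "G \<in> relaxations F \<Longrightarrow> admissible A K G"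
  by (induction rule: relaxations.induct) (use F K admissible_relax in auto)

lemma relaxations_lip: "G \<in> relaxations F \<Longrightarrow> lip A K G"
  using relaxations_admissible by (simp add: admissible_def)

lemma relaxations_le: "G \<in> relaxations F \<Longrightarrow> G e \<le> F e"
  by (induction rule: relaxations.induct) (auto intro: order_trans[OF relax_le])

text \<open>If \<open>G\<close> lies below \<open>G1\<close> and \<open>G2\<close>, relaxing it with
  the parameters of the next step of \<open>G1\<close> keeps it below \<open>G2\<close> and, by
  monotonicity, below the relaxed \<open>G1\<close>. Directedness lets one relaxation serve finitely
  many points.\<close>

lemma relaxations_directed:
  assumes "G1 \<in> relaxations F" "G2 \<in> relaxations F"
  shows "\<exists>G\<in>relaxations F. \<forall>e. G e \<le> G1 e \<and> G e \<le> G2 e"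
  using assms(1)
proof (induction rule: relaxations.induct)
  case base
  then show ?case using assms(2) relaxations_le by auto
next
  case (step G1 \<xi> c)
  then obtain G where G: "G \<in> relaxations F" "\<And>e. G e \<le> G1 e \<and> G e \<le> G2 e" by blast
  have "relax \<xi> c G e \<le> relax \<xi> c G1 e" for e
    using G by (intro relax_mono[OF relaxations_lip relaxations_lip] step) auto
  moreover have "relax \<xi> c G e \<le> G2 e" for e
    using relax_le G(2) order_trans by blast
  ultimately show ?case
    using relaxations.step[OF G(1), of \<xi> c] by blast
qed

lemma relaxations_directed_finite:
  assumes "finite S" "S \<subseteq> relaxations F"
  shows "\<exists>G\<in>relaxations F. \<forall>H\<in>S. \<forall>e. G e \<le> H e"
  using assms
proof (induction S rule: finite_induct)
  case empty
  then show ?case using relaxations.base by blast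
next
  case (insert H S)
  then obtain G where G: "G \<in> relaxations F" "\<forall>H\<in>S. \<forall>e. G e \<le> H e" by auto
  obtain G' where "G' \<in> relaxations F" "\<forall>e. G' e \<le> G e \<and> G' e \<le> H e"
    using relaxations_directed[OF G(1), of H] insert.prems by auto
  then show ?case using G(2) by (metis insertE order_trans)
qed

text \<open>Scaling by \<open>r\<close> commutes with relaxation once the amplitude \<open>c\<close>
  is replaced by \<open>c / r\<close>. Since all amplitudes occur, the infimum inherits the
  homogeneity of \<open>F\<close>.\<close>

lemma relaxations_scale:
  assumes "G \<in> relaxations F" and r: "r > 0"
  shows "\<exists>G'\<in>relaxations F. \<forall>e. G (\<lambda>\<alpha>. r * e \<alpha>) = r * G' e"
  using assms(1)
proof (induction rule: relaxations.induct)
  case base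
  then show ?case using F_scale[OF r] relaxations.base by blast
next
  case (step G \<xi> c)
  then obtain G' where G': "G' \<in> relaxations F" "\<And>e. G (\<lambda>\<alpha>. r * e \<alpha>) = r * G' e" by blast
  have "relax \<xi> c G (\<lambda>\<alpha>. r * e \<alpha>) = r * relax \<xi> (c / r) G' e" for e
  proof -
    have "line_avg G (xdir \<xi>) c (\<lambda>\<alpha>. r * e \<alpha>) = r * line_avg G' (xdir \<xi>) (c / r) e"
    proof -
      have "G (\<lambda>\<alpha>. r * e \<alpha> + c * cos t * xdir \<xi> \<alpha>) = r * G' (\<lambda>\<alpha>. e \<alpha> + c / r * cos t * xdir \<xi> \<alpha>)" for t
        using G'(2)[of "\<lambda>\<alpha>. e \<alpha> + c / r * cos t * xdir \<xi> \<alpha>"] r by (simp add: algebra_simps)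
      then show ?thesis
        by (simp add: line_avg_def avg_cmult)
    qed
    then show ?thesis
      using r by (simp add: relax_def G' min_mult_distrib_left)
  qed
  then show ?case
    using relaxations.step[OF G'(1)] by blast
qed

text \<open>All relaxations vanish at 0 and share the Lipschitz constant \<open>K\<close>.\<close>

lemma bdd_below_relaxations: "bdd_below ((\<lambda>G. G e) ` relaxations F)"
proof (rule bdd_belowI2)
  fix G assume "G \<in> relaxations F"
  then show "- (K * (\<Sum>\<alpha>\<in>A. \<bar>e \<alpha>\<bar>)) \<le> G e"
    using lip_const_nonneg(2)[of A K G e] relaxations_admissible by (simp add: admissible_def)
qed

lemma relaxations_ne: "relaxations F \<noteq> {}"
  using relaxations.base by blast

lemma envelope_le: "G \<in> relaxations F \<Longrightarrow> envelope F e \<le> G e"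
  unfolding envelope_def by (rule cINF_lower[OF bdd_below_relaxations])

lemma envelope_greatest: "(\<And>G. G \<in> relaxations F \<Longrightarrow> b \<le> G e) \<Longrightarrow> b \<le> envelope F e"
  unfolding envelope_def by (rule cINF_greatest[OF relaxations_ne])

lemma envelope_approx: "envelope F e < b \<Longrightarrow> \<exists>G\<in>relaxations F. G e < b"
  unfolding envelope_def using cINF_less_iff[OF relaxations_ne bdd_below_relaxations] by blast

lemma lip_envelope: "lip A K (envelope F)"
proof -
  have "envelope F e - K * (\<Sum>\<alpha>\<in>A. \<bar>e \<alpha> - e' \<alpha>\<bar>) \<le> envelope F e'" for e e'
  proof (rule envelope_greatest)
    fix G assume G: "G \<in> relaxations F"
    have "\<bar>G e - G e'\<bar> \<le> K * (\<Sum>\<alpha>\<in>A. \<bar>e \<alpha> - e' \<alpha>\<bar>)"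
      using relaxations_lip[OF G] by (simp add: lip_def)
    then show "envelope F e - K * (\<Sum>\<alpha>\<in>A. \<bar>e \<alpha> - e' \<alpha>\<bar>) \<le> G e'"
      using envelope_le[OF G, of e] by linarith
  qed
  from this this[of e' e for e e'] show ?thesis
    unfolding lip_def abs_le_iff by (fastforce simp: abs_minus_commute algebra_simps)
qed

lemma envelope_scale:
  assumes "r > 0"
  shows "envelope F (\<lambda>\<alpha>. r * e \<alpha>) = r * envelope F e"
proof -
  have le: "r * envelope F e \<le> envelope F (\<lambda>\<alpha>. r * e \<alpha>)" if r: "r > 0" for r e
  proof (rule envelope_greatest)
    fix G assume "G \<in> relaxations F"
    from relaxations_scale[OF this r] show "r * envelope F e \<le> G (\<lambda>\<alpha>. r * e \<alpha>)"
      using envelope_le r by auto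
  qed
  \<comment> \<open>The reverse inequality is \<open>le\<close> for the factor \<open>1 / r\<close>
    at the scaled vector.\<close>
  have "r * (1 / r * envelope F (\<lambda>\<alpha>. r * e \<alpha>)) \<le> r * envelope F (\<lambda>\<alpha>. 1 / r * (r * e \<alpha>))"
    using assms by (intro mult_left_mono le) auto
  then show ?thesis
    using le[OF assms, of e] assms by simp
qed

text \<open>The average involves the envelope on a whole segment, whereas a relaxation is chosen
  close to it at one point. A finite net, directedness and the common Lipschitz constant give one
  \<open>G\<close> within \<epsilon> of the envelope along the segment; relaxing this
  \<open>G\<close> once more yields the inequality.\<close>

lemma envelope_submean: "envelope F e \<le> line_avg (envelope F) (xdir \<xi>) c e"
proof (rule field_le_epsilon)
  fix \<epsilon> :: real assume \<epsilon>: "\<epsilon> > 0"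
  define pt where "pt s = (\<lambda>\<alpha>. e \<alpha> + c * s * xdir \<xi> \<alpha>)" for s
  define L where "L = K * (\<bar>c\<bar> * (\<Sum>\<alpha>\<in>A. \<bar>xdir \<xi> \<alpha>\<bar>))"
  have L0: "L \<ge> 0"
    unfolding L_def using K by (simp add: sum_nonneg)
  have Lip: "\<bar>H (pt s) - H (pt s')\<bar> \<le> L * \<bar>s - s'\<bar>" if "lip A K H" for H s s'
  proof -
    have "\<bar>H (pt s) - H (pt s')\<bar> \<le> K * (\<Sum>\<alpha>\<in>A. \<bar>pt s \<alpha> - pt s' \<alpha>\<bar>)"
      using that unfolding lip_def by blast
    also have "(\<Sum>\<alpha>\<in>A. \<bar>pt s \<alpha> - pt s' \<alpha>\<bar>) = (\<Sum>\<alpha>\<in>A. \<bar>c\<bar> * \<bar>s - s'\<bar> * \<bar>xdir \<xi> \<alpha>\<bar>)"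
      by (intro sum.cong refl) (simp add: pt_def flip: abs_mult, simp add: algebra_simps)
    also have "K * \<dots> = L * \<bar>s - s'\<bar>"
      by (simp add: L_def sum_distrib_left sum_distrib_right algebra_simps)
    finally show ?thesis .
  qed
  \<comment> \<open>The net error counts twice, for \<open>G\<close> and for the envelope:
    \<epsilon> / 4 each, beside \<epsilon> / 2 for the choice of \<open>H\<close>. The summand 1
    avoids division by 0.\<close>
  define \<delta> where "\<delta> = \<epsilon> / (4 * (L + 1))"
  have \<delta>: "\<delta> > 0" using \<epsilon> L0 by (simp add: \<delta>_def)
  have L\<delta>: "L * \<delta> \<le> \<epsilon> / 4"
    using \<epsilon> L0 by (simp add: \<delta>_def field_simps)
  obtain N where N: "finite N" "{-1..1::real} \<subseteq> (\<Union>s\<in>N. ball s \<delta>)"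
    using compact_Icc[of "-1::real" 1] \<delta> unfolding compact_eq_totally_bounded by blast
  have "\<exists>G\<in>relaxations F. G (pt s) < envelope F (pt s) + \<epsilon> / 2" for s
    using \<epsilon> by (intro envelope_approx) auto
  then obtain H where H: "\<And>s. H s \<in> relaxations F" "\<And>s. H s (pt s) < envelope F (pt s) + \<epsilon> / 2"
    by metis
  obtain G where G: "G \<in> relaxations F" "\<And>s e. s \<in> N \<Longrightarrow> G e \<le> H s e"
  proof -
    have "H ` N \<subseteq> relaxations F"
      using H(1) by auto
    then show thesis
      using relaxations_directed_finite[OF finite_imageI[OF N(1), of H]] that by blast
  qed
  have near: "G (pt s) \<le> envelope F (pt s) + \<epsilon>" if s: "s \<in> {-1..1}" for s
  proof -
    obtain s' where s': "s' \<in> N" "\<bar>s - s'\<bar> \<le> \<delta>"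
      using N(2) s by (force simp: dist_real_def)
    have "L * \<bar>s - s'\<bar> \<le> \<epsilon> / 4"
      using mult_left_mono[OF s'(2) L0] L\<delta> by linarith
    then show ?thesis
      using Lip[OF relaxations_lip[OF G(1)], of s s'] Lip[OF lip_envelope, of s s']
        G(2)[OF s'(1), of "pt s'"] H(2)[of s'] by linarith
  qed
  have "envelope F e \<le> relax \<xi> c G e"
    by (rule envelope_le[OF relaxations.step[OF G(1)]])
  also have "\<dots> \<le> line_avg G (xdir \<xi>) c e"
    by (simp add: relax_def)
  also have "\<dots> \<le> avg (\<lambda>t. envelope F (pt (cos t)) + \<epsilon>)"
    unfolding line_avg_def pt_def[symmetric]
    by (intro avg_mono near continuous_intros)
      (auto simp: pt_def intro!: continuous_intros lip_continuous_on[OF lip_envelope]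
        lip_continuous_on[OF relaxations_lip[OF G(1)]])
  also have "\<dots> = avg (\<lambda>t. envelope F (pt (cos t))) + \<epsilon>"
    by (subst avg_add) (auto simp: avg_const pt_def
        intro!: continuous_intros lip_continuous_on[OF lip_envelope])
  finally show "envelope F e \<le> line_avg (envelope F) (xdir \<xi>) c e + \<epsilon>"
    by (simp add: line_avg_def pt_def)
qed

lemma dir_convex_envelope: "dir_convex A K (range xdir) (envelope F)"
  unfolding dir_convex_def
proof (intro conjI allI impI ballI lip_envelope envelope_scale)
  fix x :: "nat^'d \<Rightarrow> real" and e assume "x \<in> range xdir"
  then obtain \<xi> where x: "x = xdir \<xi>" by blast
  show "convex_on UNIV (\<lambda>r. envelope F (\<lambda>\<alpha>. e \<alpha> + r * x \<alpha>))"
  proof (rule convex_on_if_submean)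
    show "continuous_on UNIV (\<lambda>r. envelope F (\<lambda>\<alpha>. e \<alpha> + r * x \<alpha>))"
      by (intro lip_continuous_on[OF lip_envelope] continuous_intros)
    show "envelope F (\<lambda>\<alpha>. e \<alpha> + r * x \<alpha>)
        \<le> avg (\<lambda>t. envelope F (\<lambda>\<alpha>. e \<alpha> + (r + c * cos t) * x \<alpha>))" for r c
      using envelope_submean[of "\<lambda>\<alpha>. e \<alpha> + r * x \<alpha>" \<xi> c]
      by (simp add: x line_avg_def algebra_simps)
  qed
qed

lemma admissible_opposite:
  assumes "finite I"
  shows "0 \<le> F (\<lambda>\<alpha>. \<Sum>i\<in>I. r i * xdir (\<xi> i) \<alpha>) + F (\<lambda>\<alpha>. - (\<Sum>i\<in>I. r i * xdir (\<xi> i) \<alpha>))"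
proof -
  have "0 \<le> envelope F (\<lambda>\<alpha>. \<Sum>i\<in>I. r i * xdir (\<xi> i) \<alpha>) + envelope F (\<lambda>\<alpha>. - (\<Sum>i\<in>I. r i * xdir (\<xi> i) \<alpha>))"
    by (rule dir_convex_opposite[OF dir_convex_envelope assms]) auto
  then show ?thesis
    using envelope_le[OF relaxations.base, of "\<lambda>\<alpha>. \<Sum>i\<in>I. r i * xdir (\<xi> i) \<alpha>"]
      envelope_le[OF relaxations.base, of "\<lambda>\<alpha>. - (\<Sum>i\<in>I. r i * xdir (\<xi> i) \<alpha>)"] by linarith
qed

end

end

section \<open>Span of the wave directions and linear dependence of functionals\<close>

lemma poly_interpolation:
  fixes p :: "'a \<Rightarrow> real"
  assumes "finite A" "inj_on p A"
  shows "\<exists>Q. \<forall>b\<in>A. poly Q (p b) = e b"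
  using assms
proof (induction A rule: finite_induct)
  case (insert a A)
  then obtain Q where Q: "\<And>b. b \<in> A \<Longrightarrow> poly Q (p b) = e b" by auto
  define R where "R = (\<Prod>b\<in>A. [:- p b, 1:])"
  have "poly R (p a) \<noteq> 0"
    using insert.prems insert.hyps by (auto simp: R_def poly_prod)
  moreover have "poly R (p b) = 0" if "b \<in> A" for b
    using that insert.hyps by (auto simp: R_def poly_prod intro!: prod_zero)
  ultimately show ?case
    using Q by (intro exI[of _ "Q + smult ((e a - poly Q (p a)) / poly R (p a)) R"]) auto
qed auto

text \<open>Distinct primes are taken as coordinates: by unique factorization the value of a
  monomial determines its exponents.\<close>

lemma exists_injective_monomials: "\<exists>\<eta>::real^'d::finite. inj (\<lambda>\<beta>::nat^'d. \<Prod>i\<in>UNIV. \<eta> $ i ^ (\<beta> $ i))"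
proof -
  obtain g :: "nat \<Rightarrow> nat" where g: "inj g" "range g \<subseteq> {p. prime p}"
    using infinite_countable_subset[OF primes_infinite] by blast
  define P where "P i = g (to_nat i)" for i :: 'd
  have P: "inj P" "\<And>i. prime (P i)"
    using g inj_compose[OF g(1) inj_to_nat] by (auto simp: P_def[abs_def] o_def)
  have mult: "multiplicity (P j) (\<Prod>i\<in>UNIV. P i ^ (\<beta> $ i)) = \<beta> $ j" for \<beta> :: "nat^'d" and j
  proof -
    have eq: "(\<Prod>i\<in>UNIV. P i ^ (\<beta> $ i)) = (\<Prod>q\<in>range P. q ^ (\<beta> $ (inv P q)))"
      by (subst prod.reindex[OF P(1)]) (simp add: P(1))
    show ?thesis
      unfolding eq using P by (subst multiplicity_prod_prime_powers) auto
  qed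
  have "inj (\<lambda>\<beta>::nat^'d. \<Prod>i\<in>UNIV. (\<chi> i. real (P i)) $ i ^ (\<beta> $ i))"
  proof (rule injI)
    fix \<beta> \<gamma> :: "nat^'d"
    assume "(\<Prod>i\<in>UNIV. (\<chi> i. real (P i)) $ i ^ (\<beta> $ i)) = (\<Prod>i\<in>UNIV. (\<chi> i. real (P i)) $ i ^ (\<gamma> $ i))"
    then have "real (\<Prod>i\<in>UNIV. P i ^ (\<beta> $ i)) = real (\<Prod>i\<in>UNIV. P i ^ (\<gamma> $ i))"
      by simp
    then have "(\<Prod>i\<in>UNIV. P i ^ (\<beta> $ i)) = (\<Prod>i\<in>UNIV. P i ^ (\<gamma> $ i))"
      by (simp only: of_nat_eq_iff)
    then show "\<beta> = \<gamma>"
      using mult by (metis vec_eq_iff)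
  qed
  then show ?thesis by blast
qed

text \<open>A monomial at the coordinatewise k-th power of \<eta> is the k-th power of
  \<open>p \<beta>\<close>, so combinations over k are polynomials in \<open>p \<beta>\<close>. The
  nodes are distinct, hence any \<open>e\<close> can be interpolated; the signs of
  \<open>xdir\<close> are moved into the prescribed values.\<close>

lemma xdir_spanning:
  fixes A :: "(nat^'d::finite) set"
  assumes "finite A"
  obtains n :: nat and r :: "nat \<Rightarrow> real" and \<xi> :: "nat \<Rightarrow> real^'d"
  where "\<And>\<beta>. \<beta> \<in> A \<Longrightarrow> (\<Sum>k\<le>n. r k * xdir (\<xi> k) \<beta>) = e \<beta>"
proof -
  obtain \<eta> :: "real^'d" where \<eta>: "inj (\<lambda>\<beta>::nat^'d. \<Prod>i\<in>UNIV. \<eta> $ i ^ (\<beta> $ i))"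
    using exists_injective_monomials by blast
  define p where "p \<beta> = (\<Prod>i\<in>UNIV. \<eta> $ i ^ (\<beta> $ i))" for \<beta> :: "nat^'d"
  obtain Q where Q: "\<And>\<beta>. \<beta> \<in> A \<Longrightarrow> poly Q (p \<beta>) = (-1) ^ (mdegree \<beta> div 2) * e \<beta>"
    using poly_interpolation[OF assms inj_on_subset[OF \<eta> subset_UNIV], of "\<lambda>\<beta>. (-1) ^ (mdegree \<beta> div 2) * e \<beta>"]
    unfolding p_def by blast
  show thesis
  proof (rule that[of "coeff Q" "\<lambda>k. \<chi> i. \<eta> $ i ^ k" "degree Q"])
    fix \<beta> assume \<beta>: "\<beta> \<in> A"
    have "xdir (\<chi> i. \<eta> $ i ^ k) \<beta> = (-1) ^ (mdegree \<beta> div 2) * p \<beta> ^ k" for k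
      by (simp add: xdir_def p_def prod_power_distrib power_mult[symmetric] mult.commute)
    then have "(\<Sum>k\<le>degree Q. coeff Q k * xdir (\<chi> i. \<eta> $ i ^ k) \<beta>) = (-1) ^ (mdegree \<beta> div 2) * poly Q (p \<beta>)"
      by (simp add: poly_altdef sum_distrib_left mult_ac)
    also have "\<dots> = e \<beta>"
      by (simp add: Q[OF \<beta>] flip: mult.assoc power_add)
    finally show "(\<Sum>k\<le>degree Q. coeff Q k * xdir (\<chi> i. \<eta> $ i ^ k) \<beta>) = e \<beta>" .
  qed
qed

text \<open>If \<open>t k\<close> is nonzero at some \<open>e0\<close> in the common kernel of the
  others, then \<open>e0\<close> spans that kernel modulo the kernel of \<open>t k\<close>.
  Subtracting the multiple of \<open>t k\<close> that agrees with \<tau> at \<open>e0\<close>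
  therefore leaves a functional to which the induction hypothesis applies.\<close>

lemma functional_in_span:
  fixes \<tau> :: "'a \<Rightarrow> real" and t :: "'j \<Rightarrow> 'a \<Rightarrow> real"
  assumes "finite J" "finite A"
    and "\<And>e. (\<And>j. j \<in> J \<Longrightarrow> (\<Sum>\<alpha>\<in>A. t j \<alpha> * e \<alpha>) = 0) \<Longrightarrow> (\<Sum>\<alpha>\<in>A. \<tau> \<alpha> * e \<alpha>) = 0"
  shows "\<exists>c. \<forall>\<alpha>\<in>A. \<tau> \<alpha> = (\<Sum>j\<in>J. c j * t j \<alpha>)"
  using assms(1,3)
proof (induction J arbitrary: \<tau> rule: finite_induct)
  case empty
  \<comment> \<open>Without constraints, \<tau> can be tested on itself.\<close>
  have "(\<Sum>\<alpha>\<in>A. \<tau> \<alpha> * \<tau> \<alpha>) = 0"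
    using empty by blast
  then have "\<forall>\<alpha>\<in>A. \<tau> \<alpha> = 0"
    using assms(2) by (simp add: sum_nonneg_eq_0_iff)
  then show ?case by simp
next
  case (insert k J)
  show ?case
  proof (cases "\<exists>e. (\<forall>j\<in>J. (\<Sum>\<alpha>\<in>A. t j \<alpha> * e \<alpha>) = 0) \<and> (\<Sum>\<alpha>\<in>A. t k \<alpha> * e \<alpha>) \<noteq> 0")
    case False
    then obtain c where c: "\<forall>\<alpha>\<in>A. \<tau> \<alpha> = (\<Sum>j\<in>J. c j * t j \<alpha>)"
      using insert.IH[of \<tau>] insert.prems by (metis insert_iff)
    have "(\<Sum>j\<in>insert k J. (c(k := 0)) j * t j \<alpha>) = (\<Sum>j\<in>J. c j * t j \<alpha>)" for \<alpha>
      using insert.hyps by (auto intro!: sum.cong)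
    then show ?thesis using c by metis
  next
    case True
    then obtain e0 where e0: "\<And>j. j \<in> J \<Longrightarrow> (\<Sum>\<alpha>\<in>A. t j \<alpha> * e0 \<alpha>) = 0" "(\<Sum>\<alpha>\<in>A. t k \<alpha> * e0 \<alpha>) \<noteq> 0"
      by blast
    define q where "q = (\<Sum>\<alpha>\<in>A. \<tau> \<alpha> * e0 \<alpha>) / (\<Sum>\<alpha>\<in>A. t k \<alpha> * e0 \<alpha>)"
    have "(\<Sum>\<alpha>\<in>A. (\<tau> \<alpha> - q * t k \<alpha>) * e \<alpha>) = 0"
      if e: "\<And>j. j \<in> J \<Longrightarrow> (\<Sum>\<alpha>\<in>A. t j \<alpha> * e \<alpha>) = 0" for e
    proof -
      define s where "s = (\<Sum>\<alpha>\<in>A. t k \<alpha> * e \<alpha>) / (\<Sum>\<alpha>\<in>A. t k \<alpha> * e0 \<alpha>)"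
      have split: "(\<Sum>\<alpha>\<in>A. u \<alpha> * (e \<alpha> - s * e0 \<alpha>)) = (\<Sum>\<alpha>\<in>A. u \<alpha> * e \<alpha>) - s * (\<Sum>\<alpha>\<in>A. u \<alpha> * e0 \<alpha>)" for u
        by (simp add: sum_subtractf sum_distrib_left algebra_simps)
      have "(\<Sum>\<alpha>\<in>A. t j \<alpha> * (e \<alpha> - s * e0 \<alpha>)) = 0" if "j \<in> insert k J" for j
        unfolding split using that e e0 by (auto simp: s_def)
      then have "(\<Sum>\<alpha>\<in>A. \<tau> \<alpha> * (e \<alpha> - s * e0 \<alpha>)) = 0"
        by (rule insert.prems)
      then have "(\<Sum>\<alpha>\<in>A. \<tau> \<alpha> * e \<alpha>) = q * (\<Sum>\<alpha>\<in>A. t k \<alpha> * e \<alpha>)"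
        unfolding split using e0(2) by (simp add: s_def q_def)
      then show ?thesis
        by (simp add: sum_subtractf sum_distrib_left algebra_simps)
    qed
    from insert.IH[OF this]
    obtain c where c: "\<forall>\<alpha>\<in>A. \<tau> \<alpha> - q * t k \<alpha> = (\<Sum>j\<in>J. c j * t j \<alpha>)"
      by blast
    have "(\<Sum>j\<in>insert k J. (c(k := q)) j * t j \<alpha>) = q * t k \<alpha> + (\<Sum>j\<in>J. c j * t j \<alpha>)" for \<alpha>
      using insert.hyps by (auto intro!: sum.cong)
    then show ?thesis
      using c by (intro exI[of _ "c(k := q)"]) (simp add: algebra_simps)
  qed
qed

section \<open>Ornstein non-inequality\<close>

text \<open>Link between the Bochner integral of the norm and the gauge integral over boxes in which
  admissibility is stated.\<close>

lemma L1_norm_eq_integral: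
  assumes g: "continuous_on UNIV g" "\<And>x. x \<notin> cbox u v \<Longrightarrow> g x = 0"
  shows "L1_norm g = integral (cbox u v) (\<lambda>x. \<bar>g x\<bar>)"
proof -
  have c: "continuous_on (cbox u v) (\<lambda>x. \<bar>g x\<bar>)"
    by (intro continuous_intros continuous_on_subset[OF g(1)]) auto
  then have "set_integrable lborel (cbox u v) (\<lambda>x. \<bar>g x\<bar>)"
    unfolding set_integrable_def by (rule borel_integrable_compact[OF compact_cbox])
  moreover have "L1_norm g = (LINT x:cbox u v|lborel. \<bar>g x\<bar>)"
    unfolding L1_norm_def set_lebesgue_integral_def
    by (intro Bochner_Integration.integral_cong) (auto simp: indicator_def g)
  ultimately show ?thesis
    by (simp add: set_borel_integral_eq_integral)
qed

text \<open>\<open>s i\<close> is the intercept on axis \<open>i\<close>, and the weights are the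
  reciprocals. \<Lambda> misses the origin, as \<open>b = 0\<close> would force the normal vector to
  vanish; hence its equation can be normalized to right-hand side 1.\<close>

lemma homogeneity_pattern_weights:
  assumes "homogeneity_pattern \<Lambda>"
  obtains a :: "real^'d::finite" and m where "0 < m" "\<And>i. m \<le> a $ i"
    "\<And>x. x \<in> \<Lambda> \<Longrightarrow> (\<Sum>i\<in>UNIV. x $ i * a $ i) = 1"
proof -
  obtain a0 b where a0: "a0 \<noteq> 0" "\<Lambda> = {x. a0 \<bullet> x = b}"
    and t: "\<And>i. \<exists>t>0. t *\<^sub>R axis i 1 \<in> \<Lambda>"
    using assms unfolding homogeneity_pattern_def by blast
  obtain s where s: "\<And>i. s i > 0" "\<And>i. s i *\<^sub>R axis i 1 \<in> \<Lambda>"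
    using t by metis
  have sb: "s i * a0 $ i = b" for i
    using s(2)[of i] by (simp add: a0 inner_axis)
  have "b \<noteq> 0"
  proof
    assume "b = 0"
    then have "a0 = 0"
      using sb s(1) by (simp add: vec_eq_iff) (metis less_irrefl)
    with a0 show False by simp
  qed
  define a where "a = (\<chi> i. 1 / s i)"
  have a: "a $ i = a0 $ i / b" for i
    using sb[of i] s(1)[of i] \<open>b \<noteq> 0\<close> by (simp add: a_def field_simps)
  show thesis
  proof
    show "0 < Min (range (\<lambda>i. a $ i))"
      using s(1) by (subst Min_gr_iff) (auto simp: a_def)
    show "Min (range (\<lambda>i. a $ i)) \<le> a $ i" for i
      by (rule Min_le) auto
    show "(\<Sum>i\<in>UNIV. x $ i * a $ i) = 1" if "x \<in> \<Lambda>" for x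
    proof -
      have "(\<Sum>i\<in>UNIV. x $ i * a $ i) = (a0 \<bullet> x) / b"
        by (simp add: a inner_vec_def sum_divide_distrib mult.commute)
      then show ?thesis
        using that a0(2) \<open>b \<noteq> 0\<close> by simp
    qed
  qed
qed

section \<open>Lipschitz constants of the integrand\<close>

lemma lip_linear:
  fixes A :: "'a set"
  shows "lip A (\<Sum>\<alpha>\<in>A. \<bar>t \<alpha>\<bar>) (\<lambda>e. \<Sum>\<alpha>\<in>A. t \<alpha> * e \<alpha>)"
proof (cases "finite A")
  case True
  show ?thesis
    unfolding lip_def
  proof (intro allI)
    fix e e' :: "'a \<Rightarrow> real"
    have "\<bar>(\<Sum>\<alpha>\<in>A. t \<alpha> * e \<alpha>) - (\<Sum>\<alpha>\<in>A. t \<alpha> * e' \<alpha>)\<bar> \<le> (\<Sum>\<alpha>\<in>A. \<bar>t \<alpha>\<bar> * \<bar>e \<alpha> - e' \<alpha>\<bar>)"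
      unfolding sum_subtractf[symmetric] right_diff_distrib[symmetric] abs_mult[symmetric]
      by (rule sum_abs)
    also have "\<dots> \<le> (\<Sum>\<alpha>\<in>A. \<bar>t \<alpha>\<bar> * (\<Sum>\<beta>\<in>A. \<bar>e \<beta> - e' \<beta>\<bar>))"
      using True by (intro sum_mono mult_left_mono member_le_sum) auto
    finally show "\<bar>(\<Sum>\<alpha>\<in>A. t \<alpha> * e \<alpha>) - (\<Sum>\<alpha>\<in>A. t \<alpha> * e' \<alpha>)\<bar>
        \<le> (\<Sum>\<alpha>\<in>A. \<bar>t \<alpha>\<bar>) * (\<Sum>\<alpha>\<in>A. \<bar>e \<alpha> - e' \<alpha>\<bar>)"
      by (simp add: sum_distrib_right)
  qed
qed (simp add: lip_def)

lemma lip_abs: "lip A K G \<Longrightarrow> lip A K (\<lambda>e. \<bar>G e\<bar>)"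
  unfolding lip_def by (meson abs_triangle_ineq3 order_trans)

lemma lip_diff:
  fixes A :: "'a set"
  assumes "lip A K G" "lip A L H"
  shows "lip A (K + L) (\<lambda>e. G e - H e)"
  unfolding lip_def
proof (intro allI)
  fix e e' :: "'a \<Rightarrow> real"
  have "\<bar>G e - G e'\<bar> \<le> K * (\<Sum>\<alpha>\<in>A. \<bar>e \<alpha> - e' \<alpha>\<bar>)" "\<bar>H e - H e'\<bar> \<le> L * (\<Sum>\<alpha>\<in>A. \<bar>e \<alpha> - e' \<alpha>\<bar>)"
    using assms by (auto simp: lip_def)
  then show "\<bar>G e - H e - (G e' - H e')\<bar> \<le> (K + L) * (\<Sum>\<alpha>\<in>A. \<bar>e \<alpha> - e' \<alpha>\<bar>)"
    by (simp add: distrib_right)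
qed

lemma lip_cmult_sum:
  fixes A :: "'a set"
  assumes "C \<ge> 0" "\<And>j. j \<in> J \<Longrightarrow> lip A (K j) (G j)"
  shows "lip A (C * (\<Sum>j\<in>J. K j)) (\<lambda>e. C * (\<Sum>j\<in>J. G j e))"
  unfolding lip_def
proof (intro allI)
  fix e e' :: "'a \<Rightarrow> real"
  have "\<bar>(\<Sum>j\<in>J. G j e) - (\<Sum>j\<in>J. G j e')\<bar> \<le> (\<Sum>j\<in>J. \<bar>G j e - G j e'\<bar>)"
    unfolding sum_subtractf[symmetric] by (rule sum_abs)
  also have "\<dots> \<le> (\<Sum>j\<in>J. K j * (\<Sum>\<alpha>\<in>A. \<bar>e \<alpha> - e' \<alpha>\<bar>))"
    using assms(2) by (intro sum_mono) (auto simp: lip_def)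
  finally have "C * \<bar>(\<Sum>j\<in>J. G j e) - (\<Sum>j\<in>J. G j e')\<bar> \<le> C * ((\<Sum>j\<in>J. K j) * (\<Sum>\<alpha>\<in>A. \<bar>e \<alpha> - e' \<alpha>\<bar>))"
    using assms(1) by (intro mult_left_mono) (simp_all add: sum_distrib_right)
  moreover have "\<bar>C * (\<Sum>j\<in>J. G j e) - C * (\<Sum>j\<in>J. G j e')\<bar> = C * \<bar>(\<Sum>j\<in>J. G j e) - (\<Sum>j\<in>J. G j e')\<bar>"
    using assms(1) by (simp add: abs_mult flip: right_diff_distrib)
  ultimately show "\<bar>C * (\<Sum>j\<in>J. G j e) - C * (\<Sum>j\<in>J. G j e')\<bar> \<le> C * (\<Sum>j\<in>J. K j) * (\<Sum>\<alpha>\<in>A. \<bar>e \<alpha> - e' \<alpha>\<bar>)"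
    by (simp add: mult.assoc)
qed

theorem theorem1:
  fixes \<Lambda> :: "(real ^ 'd::finite) set" and T :: "nat \<Rightarrow> 'd diff_op" and l :: nat
  assumes "1 \<le> l"
    and "homogeneity_pattern \<Lambda>"
    and "\<And>j. j \<in> {1..l} \<Longrightarrow> homogeneous_op \<Lambda> (T j)"
    and "same_degree_parity (T ` {1..l})"
    and "\<exists>C::real. \<forall>f\<in>test_functions.
           L1_norm (apply_op (T 1) f) \<le> C * (\<Sum>j=2..l. L1_norm (apply_op (T j) f))"
  shows "\<exists>c::nat \<Rightarrow> real. \<forall>\<alpha>.
           Poly_Mapping.lookup (T 1) \<alpha> = (\<Sum>j=2..l. c j * Poly_Mapping.lookup (T j) \<alpha>)"
proof -
  define A where "A = (\<Union>j\<in>{1..l}. Poly_Mapping.keys (T j))"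
  have finA: "finite A" by (simp add: A_def)
  have keysA: "Poly_Mapping.keys (T j) \<subseteq> A" if "j \<in> {1..l}" for j
    using that by (auto simp: A_def)
  obtain a :: "real^'d" and m where am: "0 < m" "\<And>i. m \<le> a $ i"
      "\<And>x. x \<in> \<Lambda> \<Longrightarrow> (\<Sum>i\<in>UNIV. x $ i * a $ i) = 1"
    by (rule homogeneity_pattern_weights[OF assms(2)]) (rule that)
  have hom: "(\<Sum>i\<in>UNIV. real (\<alpha> $ i) * a $ i) = 1" if \<alpha>: "\<alpha> \<in> A" for \<alpha>
  proof -
    obtain j where "j \<in> {1..l}" "\<alpha> \<in> Poly_Mapping.keys (T j)"
      using \<alpha> by (auto simp: A_def)
    then have "(\<chi> i. real (\<alpha> $ i)) \<in> newton_diagram (T j)" "newton_diagram (T j) \<subseteq> \<Lambda>"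
      using assms(3)[of j] by (auto simp: newton_diagram_def homogeneous_op_def)
    then have "(\<chi> i. real (\<alpha> $ i)) \<in> \<Lambda>"
      by blast
    from am(3)[OF this] show ?thesis by simp
  qed
  obtain p where par: "\<And>\<alpha>. \<alpha> \<in> A \<Longrightarrow> mdegree \<alpha> mod 2 = p"
  proof (cases "\<forall>\<alpha>\<in>A. even (mdegree \<alpha>)")
    case True
    then show ?thesis using that[of 0] by auto
  next
    case False
    then have "\<forall>\<alpha>\<in>A. odd (mdegree \<alpha>)"
      using assms(4) unfolding same_degree_parity_def A_def by blast
    then show ?thesis using that[of 1] by (auto simp: odd_iff_mod_2_eq_one)
  qed
  interpret anisotropic A a m p
    by unfold_locales (use finA am hom par in auto)
  define t where "t j = (\<lambda>e. \<Sum>\<alpha>\<in>A. Poly_Mapping.lookup (T j) \<alpha> * e \<alpha>)" for j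
  have t_lip: "lip A (\<Sum>\<alpha>\<in>A. \<bar>Poly_Mapping.lookup (T j) \<alpha>\<bar>) (t j)" for j
    unfolding t_def by (rule lip_linear)
  have apply_t: "apply_op (T j) f x = t j (\<lambda>\<alpha>. mpartial \<alpha> f x)" if "j \<in> {1..l}" for j f x
    unfolding apply_op_def t_def
    by (rule sum.mono_neutral_left) (use finA keysA[OF that] in \<open>auto simp: in_keys_iff\<close>)
  obtain C where C: "\<And>f. f \<in> test_functions \<Longrightarrow>
      L1_norm (apply_op (T 1) f) \<le> C * (\<Sum>j=2..l. L1_norm (apply_op (T j) f))"
    using assms(5) by blast
  \<comment> \<open>The absolute value makes the constant nonnegative, as the Lipschitz bound for
    the sum requires; the inequality persists because the norms are nonnegative.\<close>
  define F where "F e = \<bar>C\<bar> * (\<Sum>j=2..l. \<bar>t j e\<bar>) - \<bar>t 1 e\<bar>" for e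
  define K where "K = \<bar>C\<bar> * (\<Sum>j=2..l. \<Sum>\<alpha>\<in>A. \<bar>Poly_Mapping.lookup (T j) \<alpha>\<bar>)
      + (\<Sum>\<alpha>\<in>A. \<bar>Poly_Mapping.lookup (T 1) \<alpha>\<bar>)"
  have K: "K \<ge> 0"
    by (simp add: K_def sum_nonneg)
  have lipF: "lip A K F"
    unfolding K_def F_def by (intro lip_diff lip_cmult_sum lip_abs t_lip) auto
  have adm: "admissible A K F"
    unfolding admissible_def
  proof (intro conjI lipF ballI allI impI)
    show "F (\<lambda>_. 0) = 0"
      by (simp add: F_def t_def)
    fix f :: "real^'d \<Rightarrow> real" and u v
    assume f: "f \<in> test_functions" "\<forall>x. x \<notin> cbox u v \<longrightarrow> f x = 0"
    let ?D = "\<lambda>x \<alpha>. mpartial \<alpha> f x"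
    have sf: "smooth f" by (rule test_functions_smooth[OF f(1)])
    have D0: "?D x \<alpha> = 0" if "x \<notin> cbox u v" for x \<alpha>
      unfolding mpartial_eq_foldr
      by (rule foldr_partial_vanish[of "- cbox u v"]) (use that f in auto)
    have cont: "continuous_on S (\<lambda>x. t j (?D x))" for j S
      by (rule lip_mpartial_continuous[OF t_lip sf])
    have L1: "L1_norm (apply_op (T j) f) = integral (cbox u v) (\<lambda>x. \<bar>t j (?D x)\<bar>)" if "j \<in> {1..l}" for j
    proof -
      have "apply_op (T j) f = (\<lambda>x. t j (?D x))"
        by (rule ext) (rule apply_t[OF that])
      moreover have "t j (?D x) = 0" if "x \<notin> cbox u v" for x
        by (simp add: t_def D0[OF that])
      ultimately show ?thesis
        using L1_norm_eq_integral[OF cont, of u v j] by simp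
    qed
    have I: "(\<lambda>x. \<bar>t j (?D x)\<bar>) integrable_on cbox u v" for j
      by (intro integrable_continuous continuous_intros cont)
    have "0 \<le> C * (\<Sum>j=2..l. L1_norm (apply_op (T j) f)) - L1_norm (apply_op (T 1) f)"
      using C[OF f(1)] by simp
    also have "\<dots> \<le> \<bar>C\<bar> * (\<Sum>j=2..l. L1_norm (apply_op (T j) f)) - L1_norm (apply_op (T 1) f)"
      by (intro diff_right_mono mult_right_mono sum_nonneg) (auto simp: L1_norm_def)
    also have "\<dots> = integral (cbox u v) (\<lambda>x. F (?D x))"
    proof -
      have "integral (cbox u v) (\<lambda>x. F (?D x)) = integral (cbox u v) (\<lambda>x. \<bar>C\<bar> * (\<Sum>j=2..l. \<bar>t j (?D x)\<bar>))
          - integral (cbox u v) (\<lambda>x. \<bar>t 1 (?D x)\<bar>)"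
        unfolding F_def
        by (intro Henstock_Kurzweil_Integration.integral_diff I integrable_continuous continuous_intros cont)
      also have "integral (cbox u v) (\<lambda>x. \<bar>C\<bar> * (\<Sum>j=2..l. \<bar>t j (?D x)\<bar>))
          = \<bar>C\<bar> * (\<Sum>j=2..l. integral (cbox u v) (\<lambda>x. \<bar>t j (?D x)\<bar>))"
        by (simp add: Henstock_Kurzweil_Integration.integral_sum I)
      finally show ?thesis
        using assms(1) by (simp add: L1)
    qed
    finally show "0 \<le> integral (cbox u v) (\<lambda>x. F (?D x))" .
  qed
  have t_scale: "t j (\<lambda>\<alpha>. r * e \<alpha>) = r * t j e" for j r e
    by (simp add: t_def sum_distrib_left mult_ac)
  have F_scale: "F (\<lambda>\<alpha>. r * e \<alpha>) = r * F e" if "r > 0" for r e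
    using that by (simp add: F_def t_scale abs_mult sum_distrib_left algebra_simps)
  have F_nonneg: "0 \<le> F e" for e
  proof -
    \<comment> \<open>The combination equals \<open>e\<close> only on \<open>A\<close>, which is
      enough because every \<open>t j\<close> depends on these coordinates alone.\<close>
    obtain n :: nat and r :: "nat \<Rightarrow> real" and \<xi> :: "nat \<Rightarrow> real^'d"
      where e: "\<And>\<beta>. \<beta> \<in> A \<Longrightarrow> (\<Sum>k\<le>n. r k * xdir (\<xi> k) \<beta>) = e \<beta>"
      using xdir_spanning[OF finA] by blast
    have "0 \<le> F (\<lambda>\<alpha>. \<Sum>k\<le>n. r k * xdir (\<xi> k) \<alpha>) + F (\<lambda>\<alpha>. - (\<Sum>k\<le>n. r k * xdir (\<xi> k) \<alpha>))"
      by (rule admissible_opposite[OF adm K F_scale]) auto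
    moreover have "t j (\<lambda>\<alpha>. \<Sum>k\<le>n. r k * xdir (\<xi> k) \<alpha>) = t j e"
        "t j (\<lambda>\<alpha>. - (\<Sum>k\<le>n. r k * xdir (\<xi> k) \<alpha>)) = - t j e" for j
      by (simp_all add: t_def e sum_negf)
    ultimately show ?thesis
      by (simp add: F_def)
  qed
  have "\<exists>c. \<forall>\<alpha>\<in>A. Poly_Mapping.lookup (T 1) \<alpha> = (\<Sum>j\<in>{2..l}. c j * Poly_Mapping.lookup (T j) \<alpha>)"
  proof (rule functional_in_span[OF _ finA])
    fix e :: "nat^'d \<Rightarrow> real"
    assume "\<And>j. j \<in> {2..l} \<Longrightarrow> (\<Sum>\<alpha>\<in>A. Poly_Mapping.lookup (T j) \<alpha> * e \<alpha>) = 0"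
    \<comment> \<open>On the common kernel of the other operators \<open>F e\<close> reduces to
      minus the absolute value of \<open>t 1 e\<close>, and it is nonnegative.\<close>
    then show "(\<Sum>\<alpha>\<in>A. Poly_Mapping.lookup (T 1) \<alpha> * e \<alpha>) = 0"
      using F_nonneg[of e] by (simp add: F_def t_def)
  qed simp
  then obtain c where c: "\<And>\<alpha>. \<alpha> \<in> A \<Longrightarrow>
      Poly_Mapping.lookup (T 1) \<alpha> = (\<Sum>j=2..l. c j * Poly_Mapping.lookup (T j) \<alpha>)"
    by blast
  have "Poly_Mapping.lookup (T j) \<alpha> = 0" if "j \<in> {1..l}" "\<alpha> \<notin> A" for j \<alpha>
    using keysA[OF that(1)] that(2) by (auto simp: in_keys_iff)
  then have "Poly_Mapping.lookup (T 1) \<alpha> = (\<Sum>j=2..l. c j * Poly_Mapping.lookup (T j) \<alpha>)" for \<alpha>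
    using c[of \<alpha>] assms(1) by (cases "\<alpha> \<in> A") auto
  then show ?thesis by blast
qed

end
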